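(* Let $N\in\mathbb C$ and $\hbar\neq0$. The space of formal power series $Z$ in the odd times $t_1,t_3,t_5,\dots$ satisfying $$\hbar\,\widehat{\mathcal L}^{(N)}_m Z=\frac{\partial Z}{\partial t_{2m+1}}\quad\text{for all } m\ge0$$ is one-dimensional; it is spanned by the generalized BGW tau-function $\tau_N(\mathbf t,\hbar)$, which is the unique solution with $Z(\mathbf 0)=1$.
   Context: The Virasoro operators are $$\widehat{\mathcal L}^{(N)}_m=\frac12\sum_{k\ge0}(2k+1)t_{2k+1}\frac{\partial}{\partial t_{2k+2m+1}}+\frac14\sum_{\substack{a+b=m-1\\ a,b\ge0}}\frac{\partial^2}{\partial t_{2a+1}\partial t_{2b+1}}+\Big(\frac1{16}-\frac{N^2}{4}\Big)\delta_{m,0}.$$ For $k\ge1$ and $j\in\mathbb C$ put $a_k(j)=\prod_{i=1}^k\big(4(j-1)^2-(2i-1)^2\big)$, and for $j\in\mathbb Z$ let $\Phi^{(N)}_j(\lambda)=\lambda^{j-1}\big(1+\sum_{k\ge1}\frac{(-\hbar)^k a_k(j-N)}{16^k k!}\lambda^{-k}\big)$. The generalized BGW tau-function $\tau_N(\mathbf t,\hbar)$ is the formal power series in $\mathbf t=(t_1,t_2,\dots)$ such that for every $M\ge1$, under $t_k=\frac1k\sum_{i=1}^M\lambda_i^{-k}$, $\tau_N=\det_{i,j=1}^M\big(\Phi^{(N)}_j(\lambda_i)\big)/\prod_{i<j}(\lambda_j-\lambda_i)$; it depends only on odd times. *)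

theory Defs
  imports Complex_Main "HOL-Library.Poly_Mapping" "HOL-Combinatorics.Permutations"
begin

text \<open>Formal power series (complex coefficients) in countably many commuting
variables y_0, y_1, ...: a coefficient for every monomial, the monomial being a
finitely supported exponent vector.\<close>
type_synonym mser = "(nat \<Rightarrow>\<^sub>0 nat) \<Rightarrow> complex"

definition ms_one :: mser where
  "ms_one \<beta> = (if \<beta> = 0 then 1 else 0)"

definition ms_mult :: "mser \<Rightarrow> mser \<Rightarrow> mser" where
  "ms_mult f g \<beta> = (\<Sum>p\<in>{p. fst p + snd p = \<beta>}. f (fst p) * g (snd p))"

primrec ms_pow :: "mser \<Rightarrow> nat \<Rightarrow> mser" where
  "ms_pow f 0 = ms_one"
| "ms_pow f (Suc n) = ms_mult f (ms_pow f n)"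

definition ms_prodl :: "mser list \<Rightarrow> mser" where
  "ms_prodl fs = foldr ms_mult fs ms_one"

definition ms_var :: "nat \<Rightarrow> mser" where
  "ms_var i \<beta> = (if \<beta> = Poly_Mapping.single i 1 then 1 else 0)"

text \<open>Series in the odd times: variable index k stands for t_{2k+1}.
Partial derivative with respect to t_{2k+1}.\<close>
definition dT :: "nat \<Rightarrow> mser \<Rightarrow> mser" where
  "dT k Z \<alpha> = of_nat (Poly_Mapping.lookup \<alpha> k + 1) * Z (\<alpha> + Poly_Mapping.single k 1)"

definition mulT :: "nat \<Rightarrow> mser \<Rightarrow> mser" where
  "mulT k Z \<alpha> = (if Poly_Mapping.lookup \<alpha> k \<ge> 1 then Z (\<alpha> - Poly_Mapping.single k 1) else 0)"

text \<open>Virasoro operator L_m^{(N)}. The infinite sum over k is written coefficientwise: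
the coefficient of t^alpha in (2k+1) t_{2k+1} dZ/dt_{2k+2m+1} vanishes unless k is in Poly_Mapping.keys alpha.\<close>
definition virasoro :: "complex \<Rightarrow> nat \<Rightarrow> mser \<Rightarrow> mser" where
  "virasoro N m Z \<alpha> =
     (1/2) * (\<Sum>k\<in>Poly_Mapping.keys \<alpha>. of_nat (2*k+1) * mulT k (dT (k+m) Z) \<alpha>)
   + (1/4) * (\<Sum>a<m. dT a (dT (m - 1 - a) Z) \<alpha>)
   + (if m = 0 then (1/16 - N^2/4) * Z \<alpha> else 0)"

definition is_BGW_solution :: "complex \<Rightarrow> complex \<Rightarrow> mser \<Rightarrow> bool" where
  "is_BGW_solution N hbar Z \<longleftrightarrow> (\<forall>m. (\<lambda>\<alpha>. hbar * virasoro N m Z \<alpha>) = dT m Z)"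

definition a_coef :: "nat \<Rightarrow> complex \<Rightarrow> complex" where
  "a_coef k j = (\<Prod>i=1..k. 4*(j-1)^2 - (of_nat (2*i-1))^2)"

text \<open>Coefficient of lambda^{j-1-k} in Phi_j^{(N)}(lambda) (c_0 = 1).\<close>
definition phi_coef :: "complex \<Rightarrow> complex \<Rightarrow> int \<Rightarrow> nat \<Rightarrow> complex" where
  "phi_coef N hbar j k =
     (if k = 0 then 1 else (-hbar)^k * a_coef k (of_int j - N) / (16^k * of_nat (fact k)))"

text \<open>Miwa variables x_i = lambda_i^{-1} (i < M) are the series variables.
Image of t_{2k+1} = 1/(2k+1) sum_{i<M} x_i^{2k+1}.\<close>
definition miwa_t :: "nat \<Rightarrow> nat \<Rightarrow> mser" where
  "miwa_t M k \<beta> =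
     (if \<exists>i<M. \<beta> = Poly_Mapping.single i (2*k+1) then 1 / of_nat (2*k+1) else 0)"

definition tot_deg :: "(nat \<Rightarrow>\<^sub>0 nat) \<Rightarrow> nat" where
  "tot_deg \<beta> = (\<Sum>i\<in>Poly_Mapping.keys \<beta>. Poly_Mapping.lookup \<beta> i)"

definition odd_weight :: "(nat \<Rightarrow>\<^sub>0 nat) \<Rightarrow> nat" where
  "odd_weight \<alpha> = (\<Sum>k\<in>Poly_Mapping.keys \<alpha>. (2*k+1) * Poly_Mapping.lookup \<alpha> k)"

definition miwa_monomial :: "nat \<Rightarrow> (nat \<Rightarrow>\<^sub>0 nat) \<Rightarrow> mser" where
  "miwa_monomial M \<alpha> =
     ms_prodl (map (\<lambda>k. ms_pow (miwa_t M k) (Poly_Mapping.lookup \<alpha> k)) (sorted_list_of_set (Poly_Mapping.keys \<alpha>)))"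

text \<open>Miwa substitution of a series in the odd times; the image of t^alpha is homogeneous of
degree odd_weight alpha in the x's, so each coefficient is a finite sum.\<close>
definition miwa :: "nat \<Rightarrow> mser \<Rightarrow> mser" where
  "miwa M Z \<beta> = (\<Sum>\<alpha>\<in>{\<alpha>. odd_weight \<alpha> = tot_deg \<beta>}. Z \<alpha> * miwa_monomial M \<alpha> \<beta>)"

text \<open>Matrix entry (i,j), 0-based, of det( x_i^{M-1-j} * x_i^{j} Phi_{j+1}(1/x_i) ):
x_i^{M-1-j} (1 + sum_k c_{j+1,k} x_i^k).\<close>
definition bgw_entry :: "complex \<Rightarrow> complex \<Rightarrow> nat \<Rightarrow> nat \<Rightarrow> nat \<Rightarrow> mser" where
  "bgw_entry N hbar M i j \<beta> =
     (if (\<exists>n. \<beta> = Poly_Mapping.single i n) \<and> Poly_Mapping.lookup \<beta> i \<ge> M - 1 - j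
      then phi_coef N hbar (int j + 1) (Poly_Mapping.lookup \<beta> i - (M - 1 - j)) else 0)"

definition bgw_det :: "complex \<Rightarrow> complex \<Rightarrow> nat \<Rightarrow> mser" where
  "bgw_det N hbar M \<beta> =
     (\<Sum>\<sigma>\<in>{\<sigma>. \<sigma> permutes {0..<M}}.
        of_int (sign \<sigma>) * ms_prodl (map (\<lambda>i. bgw_entry N hbar M i (\<sigma> i)) [0..<M]) \<beta>)"

definition vandermonde :: "nat \<Rightarrow> mser" where
  "vandermonde M = ms_prodl (map (\<lambda>(i,j). (\<lambda>\<beta>. ms_var i \<beta> - ms_var j \<beta>))
                      [(i,j). j \<leftarrow> [0..<M], i \<leftarrow> [0..<j]])"

text \<open>The generalized BGW tau-function, characterized as in the paper:
for every M \<ge> 1, tau(t_k = 1/k sum lambda_i^{-k}) = det Phi_j(lambda_i) / prod_{i<j}(lambda_j - lambda_i).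
Rewritten in x_i = 1/lambda_i (clearing the common factor prod x_i^{M-1}) as the identity of
formal power series  tau|_Miwa * prod_{i<j}(x_i - x_j) = det(x_i^{M-j} Phi_j(1/x_i) x_i^{j-1}).\<close>
definition is_BGW_tau :: "complex \<Rightarrow> complex \<Rightarrow> mser \<Rightarrow> bool" where
  "is_BGW_tau N hbar \<tau> \<longleftrightarrow>
     (\<forall>M\<ge>1. ms_mult (miwa M \<tau>) (vandermonde M) = bgw_det N hbar M)"

end

theory Submission
  imports Defs
begin

text \<open>Since \<open>L\<^sub>m\<close> lowers the weight (\<open>t\<^sub>2\<^sub>k\<^sub>+\<^sub>1\<close> having weight \<open>2k+1\<close>) by \<open>2m\<close> and \<open>\<partial>/\<partial>t\<^sub>2\<^sub>m\<^sub>+\<^sub>1\<close>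
  by \<open>2m+1\<close>, the constraints determine a solution \<open>Z\<close> weight by weight from \<open>Z 0\<close>, and
  \<open>[L\<^sub>m, L\<^sub>n] = (m - n) L\<^sub>m\<^sub>+\<^sub>n\<close> is exactly the integrability condition for its existence.

  To identify \<open>Z\<close> with the tau-function, sum the constraints against the power sums \<open>p\<^sub>2\<^sub>m\<close> of the
  Miwa variables. After multiplication by the Vandermonde product \<open>\<Delta>\<close> all interaction terms cancel,
  and \<open>\<Delta> Z\<close> satisfies the free equation
  \<open>\<Sum>\<^sub>i (hbar/4 (x\<^sub>i\<^sup>2 \<partial>\<^sub>i\<^sup>2 + 2 x\<^sub>i \<partial>\<^sub>i + 1/4 - N\<^sup>2) - \<partial>\<^sub>i) f = const f\<close>. The determinant satisfies it too,
  because the one-variable operator is triangular on its columns. Both sides are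
  compatible with setting the last variable to zero, and the equation has at most one such family
  of solutions. Finally, the tau-function is determined by its Miwa images, since a
  series killed by the Miwa substitution for all \<open>M\<close> has all its derivatives killed as well.\<close>

subsection \<open>Virasoro operators on series in the odd times\<close>

text \<open>The weights \<open>p_{2m}\<close> are forced: on Miwa images
  \<open>\<Sum>i \<partial>/\<partial>x_i\<close> acts as
  \<open>\<Sum>k p_{2k} \<partial>/\<partial>t_{2k+1}\<close>. The price is that infinitely many
  constraints shrink to one scalar equation for each \<open>M\<close>, which for
  \<open>M \<ge> 2\<close> has many solutions. This is why both sides are treated as families in
  \<open>M\<close>; for the numerators, setting \<open>x_M = 0\<close> produces the extra factor
  \<open>x_0 ... x_{M-1}\<close> of the Vandermonde product. The interaction terms cancel because,
  in the sum over \<open>k\<close> of the products \<open>p_{2k+1} p_{2(n-k)}\<close>, the pairs of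
  distinct variables contribute exactly the quotients of \<open>x_i^{2n+2} - x_j^{2n+2}\<close> by
  \<open>x_i - x_j\<close>, and these also make up a logarithmic derivative of the Vandermonde
  product. The constant of the free equation has to come out the same on both sides. For the
  Vandermonde product it is an eigenvalue, \<open>\<Sum>j<M. j(j+1)\<close>, obtained by applying
  the uniqueness of stable families at \<open>N = hbar = 0\<close>. For the determinant it is a
  trace over the columns, in which the part linear in \<open>N\<close> cancels. Infinite series are
  avoided by splitting every Miwa image into homogeneous polynomials.\<close>

abbreviation lookp :: "('a \<Rightarrow>\<^sub>0 'b::zero) \<Rightarrow> 'a \<Rightarrow> 'b" where
  "lookp \<equiv> Poly_Mapping.lookup"

abbreviation exp1 :: "nat \<Rightarrow> (nat \<Rightarrow>\<^sub>0 nat)" where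
  "exp1 k \<equiv> Poly_Mapping.single k (Suc 0)"

lemma exp1_diff_add: "Suc 0 \<le> lookp \<alpha> k \<Longrightarrow> \<alpha> - exp1 k + exp1 k = \<alpha>"
  by (intro poly_mapping_eqI) (auto simp: lookup_add lookup_minus lookup_single when_def)

lemma exp1_add_diff: "Suc 0 \<le> lookp \<alpha> k \<Longrightarrow> \<alpha> + \<beta> - exp1 k = \<alpha> - exp1 k + \<beta>"
  by (intro poly_mapping_eqI) (auto simp: lookup_add lookup_minus lookup_single when_def)

lemma keys_add_exp1: "Poly_Mapping.keys (\<alpha> + exp1 k) = insert k (Poly_Mapping.keys \<alpha>)"
  by (auto simp: in_keys_iff lookup_add lookup_single when_def split: if_splits)

lemmas dT_eq = dT_def[unfolded One_nat_def]
lemmas mulT_eq = mulT_def[unfolded One_nat_def]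

lemma dT_commute: "dT a (dT b Z) = dT b (dT a Z)"
  by (rule ext) (auto simp: dT_def lookup_add lookup_single when_def ac_simps)

lemma dT_mulT: "dT n (mulT k Z) \<alpha> = mulT k (dT n Z) \<alpha> + (if n = k then Z \<alpha> else 0)"
  by (cases "n = k")
     (auto simp: dT_def mulT_def lookup_add lookup_minus lookup_single when_def exp1_diff_add
        exp1_add_diff not_le of_nat_diff distrib_right)

lemma mulT_commute: "mulT a (mulT b Z) = mulT b (mulT a Z)"
proof
  fix \<alpha>
  show "mulT a (mulT b Z) \<alpha> = mulT b (mulT a Z) \<alpha>"
    by (cases "a = b")
      (auto simp: mulT_def lookup_minus lookup_single when_def diff_diff_add add.commute)
qed

lemma mulT_outside: "k \<notin> Poly_Mapping.keys \<alpha> \<Longrightarrow> mulT k Z \<alpha> = 0"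
  by (simp add: mulT_def in_keys_iff)

text \<open>A common bound \<open>K\<close> replaces the index set, which depends on the monomial,
  so that \<open>L_m\<close> at neighbouring monomials is a sum over the same range.\<close>

lemma virasoro_upto:
  assumes "Poly_Mapping.keys \<alpha> \<subseteq> {..<K}"
  shows "virasoro N m Z \<alpha> =
     (1/2) * (\<Sum>k<K. of_nat (2*k+1) * mulT k (dT (k+m) Z) \<alpha>)
   + (1/4) * (\<Sum>a<m. dT a (dT (m - 1 - a) Z) \<alpha>)
   + (if m = 0 then (1/16 - N^2/4) * Z \<alpha> else 0)"
proof -
  have "(\<Sum>k\<in>Poly_Mapping.keys \<alpha>. of_nat (2*k+1) * mulT k (dT (k+m) Z) \<alpha>)
      = (\<Sum>k<K. of_nat (2*k+1) * mulT k (dT (k+m) Z) \<alpha>)"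
    by (rule sum.mono_neutral_left) (use assms mulT_outside in auto)
  then show ?thesis by (simp add: virasoro_def)
qed

lemma keys_bounded: "\<exists>K. \<forall>K'\<ge>K. Poly_Mapping.keys (\<alpha> :: nat \<Rightarrow>\<^sub>0 nat) \<subseteq> {..<K'}"
proof -
  obtain K where "\<forall>k\<in>Poly_Mapping.keys \<alpha>. k < K"
    using finite_nat_set_iff_bounded[of "Poly_Mapping.keys \<alpha>"] by auto
  then show ?thesis by (meson lessThan_iff less_le_trans subsetI)
qed

lemma dT_linear:
  "dT k (\<lambda>\<beta>. f \<beta> + g \<beta>) \<alpha> = dT k f \<alpha> + dT k g \<alpha>"
  "dT k (\<lambda>\<beta>. c * f \<beta>) \<alpha> = c * dT k f \<alpha>"
  "dT k (\<lambda>\<beta>. \<Sum>i\<in>I. h i \<beta>) \<alpha> = (\<Sum>i\<in>I. dT k (h i) \<alpha>)"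
  by (auto simp: dT_def algebra_simps sum_distrib_left)

lemma mulT_linear:
  "mulT k (\<lambda>\<beta>. f \<beta> + g \<beta>) \<alpha> = mulT k f \<alpha> + mulT k g \<alpha>"
  "mulT k (\<lambda>\<beta>. c * f \<beta>) \<alpha> = c * mulT k f \<alpha>"
  "mulT k (\<lambda>\<beta>. \<Sum>i\<in>I. h i \<beta>) \<alpha> = (\<Sum>i\<in>I. mulT k (h i) \<alpha>)"
  by (auto simp: mulT_def algebra_simps sum_distrib_left)

lemma dT_linear_ext:
  "dT k (\<lambda>\<beta>. f \<beta> + g \<beta>) = (\<lambda>\<alpha>. dT k f \<alpha> + dT k g \<alpha>)"
  "dT k (\<lambda>\<beta>. c * f \<beta>) = (\<lambda>\<alpha>. c * dT k f \<alpha>)"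
  "dT k (\<lambda>\<beta>. \<Sum>i\<in>I. h i \<beta>) = (\<lambda>\<alpha>. \<Sum>i\<in>I. dT k (h i) \<alpha>)"
  by (auto simp: dT_linear)

lemma virasoro_linear:
  "virasoro N m (\<lambda>\<beta>. f \<beta> + g \<beta>) \<alpha> = virasoro N m f \<alpha> + virasoro N m g \<alpha>"
  "virasoro N m (\<lambda>\<beta>. c * f \<beta>) \<alpha> = c * virasoro N m f \<alpha>"
  by (auto simp: virasoro_def dT_linear_ext mulT_linear sum.distrib algebra_simps sum_distrib_left add_divide_distrib)

lemma virasoro_zero: "virasoro N m (\<lambda>\<beta>. 0) \<alpha> = 0"
  using virasoro_linear(2)[of N m 0 "\<lambda>\<beta>. 0"] by simp

lemma virasoro_sum:
  "virasoro N m (\<lambda>\<beta>. \<Sum>i\<in>I. h i \<beta>) \<alpha> = (\<Sum>i\<in>I. virasoro N m (h i) \<alpha>)"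
  by (induction I rule: infinite_finite_induct) (auto simp: virasoro_zero virasoro_linear)

text \<open>Among the coefficients of \<open>L_m\<close> only the factor \<open>t_{2n+1}\<close> of
  the first sum fails to commute with the derivative.\<close>

lemma dT_virasoro:
  "dT n (virasoro N m f) \<alpha> = virasoro N m (dT n f) \<alpha> + of_nat (2*n+1) / 2 * dT (n + m) f \<alpha>"
proof -
  obtain K where K: "\<forall>K'\<ge>K. Poly_Mapping.keys \<alpha> \<subseteq> {..<K'}" using keys_bounded by blast
  define J where "J = max K (Suc n)"
  have J: "Poly_Mapping.keys \<alpha> \<subseteq> {..<J}" "n < J"
    using K by (auto simp: J_def)
  have J': "Poly_Mapping.keys (\<alpha> + exp1 n) \<subseteq> {..<J}"
    using J by (simp add: keys_add_exp1)
  have step: "of_nat (2*k+1) * dT n (mulT k (dT (k+m) f)) \<alpha> = of_nat (2*k+1) * mulT k (dT (k+m) (dT n f)) \<alpha>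
     + (if n = k then of_nat (2*k+1) * dT (k+m) f \<alpha> else 0)" for k
    by (simp add: dT_mulT dT_commute[of n] distrib_left)
  have "dT n (virasoro N m f) \<alpha> =
     (1/2) * (\<Sum>k<J. of_nat (2*k+1) * dT n (mulT k (dT (k+m) f)) \<alpha>)
   + (1/4) * (\<Sum>a<m. dT n (dT a (dT (m - 1 - a) f)) \<alpha>)
   + (if m = 0 then (1/16 - N^2/4) * dT n f \<alpha> else 0)"
    unfolding dT_eq[of n] virasoro_upto[OF J'] by (simp add: algebra_simps sum_distrib_left add_divide_distrib)
  also have "\<dots> = virasoro N m (dT n f) \<alpha> + (1/2) * (\<Sum>k<J. if n = k then of_nat (2*k+1) * dT (k+m) f \<alpha> else 0)"
    unfolding virasoro_upto[OF J(1)] step sum.distrib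
    by (simp add: dT_commute[of n] distrib_left)
  also have "\<dots> = virasoro N m (dT n f) \<alpha> + of_nat (2*n+1) / 2 * dT (n + m) f \<alpha>"
    using J(2) by simp
  finally show ?thesis .
qed

text \<open>Multiplication by \<open>t_{2l+1}\<close> fails to commute only with derivatives in the
  same variable. For \<open>m \<le> l\<close> this is the term \<open>k = l - m\<close> of the first
  sum; otherwise it is the two terms \<open>a = l\<close> and \<open>a = m-1-l\<close> of the
  second, whose coefficients 1/4 add up to 1/2.\<close>

lemma mulT_virasoro:
  "mulT l (virasoro N m f) \<alpha> = virasoro N m (mulT l f) \<alpha>
     - (if m \<le> l then of_nat (2*(l-m)+1) / 2 * mulT (l-m) f \<alpha> else 1/2 * dT (m-1-l) f \<alpha>)"
proof -
  obtain K where K: "\<forall>K'\<ge>K. Poly_Mapping.keys \<alpha> \<subseteq> {..<K'}" using keys_bounded by blast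
  define J where "J = max K (Suc l)"
  have J: "Poly_Mapping.keys \<alpha> \<subseteq> {..<J}" "l < J"
    using K by (auto simp: J_def)
  have J': "Poly_Mapping.keys (\<alpha> - exp1 l) \<subseteq> {..<J}"
    using J by (auto simp: subset_iff in_keys_iff lookup_minus)
  have 1: "mulT l (virasoro N m f) \<alpha> =
     (1/2) * (\<Sum>k<J. of_nat (2*k+1) * mulT l (mulT k (dT (k+m) f)) \<alpha>)
   + (1/4) * (\<Sum>a<m. mulT l (dT a (dT (m - 1 - a) f)) \<alpha>)
   + (if m = 0 then (1/16 - N^2/4) * mulT l f \<alpha> else 0)"
    unfolding mulT_eq[of l] virasoro_upto[OF J'] by (simp add: algebra_simps sum_distrib_left add_divide_distrib)
  have dm: "dT k (mulT l g) = (\<lambda>\<beta>. mulT l (dT k g) \<beta> + (if k = l then 1 else 0) * g \<beta>)" for k g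
    by (auto simp: dT_mulT)
  have 2: "virasoro N m (mulT l f) \<alpha> =
     (1/2) * (\<Sum>k<J. of_nat (2*k+1) * mulT l (mulT k (dT (k+m) f)) \<alpha> + (if k + m = l then of_nat (2*k+1) * mulT k f \<alpha> else 0))
   + (1/4) * (\<Sum>a<m. mulT l (dT a (dT (m - 1 - a) f)) \<alpha> + (if a = l then dT (m-1-a) f \<alpha> else 0) + (if m-1-a = l then dT a f \<alpha> else 0))
   + (if m = 0 then (1/16 - N^2/4) * mulT l f \<alpha> else 0)"
    unfolding virasoro_upto[OF J(1)] dm dT_linear mulT_linear dT_mulT
    by (intro arg_cong2[where f="(+)"] arg_cong2[where f="(*)"] sum.cong refl)
       (auto simp: mulT_commute[of l] algebra_simps)
  have 3: "(\<Sum>k<J. if k + m = l then of_nat (2*k+1) * mulT k f \<alpha> else 0)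
      = (if m \<le> l then of_nat (2*(l-m)+1) * mulT (l-m) f \<alpha> else 0)" (is "?a = ?b")
  proof -
    have "?a = (\<Sum>k<J. if k = l - m then (if m \<le> l then of_nat (2*k+1) * mulT k f \<alpha> else 0) else 0)"
      by (rule sum.cong) auto
    also have "\<dots> = ?b" using J(2) by (subst sum.delta) auto
    finally show ?thesis .
  qed
  have 4: "(\<Sum>a<m. if a = l then dT (m-1-a) f \<alpha> else 0) = (if m \<le> l then 0 else dT (m-1-l) f \<alpha>)"
    by simp
  have 5: "(\<Sum>a<m. if m-1-a = l then dT a f \<alpha> else 0) = (if m \<le> l then 0 else dT (m-1-l) f \<alpha>)"
  proof -
    have "(\<Sum>a<m. if m-1-a = l then dT a f \<alpha> else 0) = (\<Sum>a<m. if a = m-1-l then (if l < m then dT a f \<alpha> else 0) else 0)"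
      by (rule sum.cong) auto
    also have "\<dots> = (if m \<le> l then 0 else dT (m-1-l) f \<alpha>)"
      by (subst sum.delta) auto
    finally show ?thesis .
  qed
  show ?thesis
    unfolding 1 2 sum.distrib 3 4 5 by (auto simp: algebra_simps)
qed


text \<open>Allows \<open>L_m f\<close> to be replaced by its truncated form under another operator,
  although the two agree only on monomials with bounded variables.\<close>

lemma virasoro_local:
  assumes "Poly_Mapping.keys \<alpha> \<subseteq> {..<K}"
    and eq: "\<And>\<beta>. Poly_Mapping.keys \<beta> \<subseteq> {..<K+m} \<Longrightarrow> f \<beta> = g \<beta>"
  shows "virasoro N m f \<alpha> = virasoro N m g \<alpha>"
proof -
  have b: "Poly_Mapping.keys \<alpha> \<subseteq> {..<K+m}" using assms(1) by auto
  have k: "mulT k (dT (k + m) f) \<alpha> = mulT k (dT (k + m) g) \<alpha>" if "k \<in> Poly_Mapping.keys \<alpha>" for k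
  proof -
    have "Poly_Mapping.keys (\<alpha> - exp1 k) \<subseteq> {..<K+m}"
      using b by (auto simp: subset_iff in_keys_iff lookup_minus)
    moreover have "k + m < K + m" using that assms(1) by auto
    ultimately have "f (\<alpha> - exp1 k + exp1 (k+m)) = g (\<alpha> - exp1 k + exp1 (k+m))"
      by (intro eq) (simp add: keys_add_exp1)
    then show ?thesis by (simp add: mulT_eq dT_eq)
  qed
  have a: "dT a (dT (m - 1 - a) f) \<alpha> = dT a (dT (m - 1 - a) g) \<alpha>" if "a < m" for a
  proof -
    have "a < K + m" "m - 1 - a < K + m" using that by auto
    then have "f (\<alpha> + exp1 a + exp1 (m-1-a)) = g (\<alpha> + exp1 a + exp1 (m-1-a))"
      using b by (intro eq) (simp add: keys_add_exp1)
    then show ?thesis by (simp add: dT_eq)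
  qed
  show ?thesis unfolding virasoro_def using k a eq[OF b] by simp
qed

text \<open>Reflecting \<open>b\<close> inside \<open>{..<n}\<close> turns the second sum into the
  lower part of one sum over \<open>b < m + n\<close> with weight \<open>w b = 2b - 2n + 1\<close>.
  Averaging this with its own reflection leaves a constant weight, since
  \<open>w b + w (m+n-1-b) = 2(m - n)\<close>.\<close>

lemma triangle_sum_symmetric:
  fixes S :: "nat \<Rightarrow> complex"
  assumes sym: "\<And>a. a < m + n \<Longrightarrow> S a = S (m + n - 1 - a)"
  shows "(\<Sum>k<m. of_nat (2*k+1) * S (k+n)) - (\<Sum>a<n. of_nat (2*a+1) * S (a+m))
       = (of_nat m - of_nat n) * (\<Sum>a<m+n. S a)"
proof -
  define w :: "nat \<Rightarrow> complex" where "w b = 2 * of_nat b - 2 * of_nat n + 1" for b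
  have split: "(\<Sum>b<m+n. f b) = (\<Sum>b<n. f b) + (\<Sum>k<m. f (k+n))" for f :: "nat \<Rightarrow> complex"
    by (induction m) simp_all
  have "(\<Sum>b<n. w b * S b) = (\<Sum>b<n. w (n - Suc b) * S (n - Suc b))"
    by (rule sum.nat_diff_reindex[symmetric])
  also have "\<dots> = (\<Sum>b<n. - (of_nat (2*b+1) * S (b+m)))"
  proof (rule sum.cong[OF refl])
    fix b assume b: "b \<in> {..<n}"
    then have "S (n - Suc b) = S (b + m)"
      using sym[of "n - Suc b"] by (simp add: algebra_simps)
    then show "w (n - Suc b) * S (n - Suc b) = - (of_nat (2*b+1) * S (b+m))"
      using b by (simp add: w_def of_nat_diff algebra_simps)
  qed
  finally have 1: "(\<Sum>b<m+n. w b * S b)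
     = (\<Sum>k<m. of_nat (2*k+1) * S (k+n)) - (\<Sum>a<n. of_nat (2*a+1) * S (a+m))"
    by (subst split) (simp add: sum_negf, simp add: w_def add.commute)
  have "(\<Sum>b<m+n. w b * S b) = (\<Sum>b<m+n. w (m+n - Suc b) * S (m+n - Suc b))"
    by (rule sum.nat_diff_reindex[symmetric])
  also have "\<dots> = (\<Sum>b<m+n. w (m+n - Suc b) * S b)"
  proof (rule sum.cong[OF refl])
    fix b assume "b \<in> {..<m+n}"
    then have "S b = S (m + n - Suc b)" using sym[of b] by simp
    then show "w (m+n - Suc b) * S (m+n - Suc b) = w (m+n - Suc b) * S b" by (simp only:)
  qed
  finally have "2 * (\<Sum>b<m+n. w b * S b) = (\<Sum>b<m+n. w b * S b) + (\<Sum>b<m+n. w (m+n - Suc b) * S b)"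
    by simp
  also have "\<dots> = (\<Sum>b<m+n. 2 * (of_nat m - of_nat n) * S b)"
    unfolding sum.distrib[symmetric]
    by (rule sum.cong[OF refl]) (simp add: w_def of_nat_diff algebra_simps)
  also have "\<dots> = 2 * ((of_nat m - of_nat n) * (\<Sum>b<m+n. S b))"
    by (simp only: sum_distrib_left mult.assoc)
  finally have "(\<Sum>b<m+n. w b * S b) = (of_nat m - of_nat n) * (\<Sum>b<m+n. S b)"
    by (simp only: mult_cancel_left) simp
  then show ?thesis unfolding 1 .
qed

text \<open>The outer \<open>L_m\<close> is expanded and \<open>L_n\<close> is moved to the front of
  each term. The first-order corrections \<open>T\<close> combine termwise with factor
  \<open>m - n\<close>; the second-order corrections \<open>S\<close> do so only after summation, by
  \<open>triangle_sum_symmetric\<close>.\<close>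

lemma virasoro_commutator:
  "virasoro N m (virasoro N n f) \<alpha> - virasoro N n (virasoro N m f) \<alpha>
     = (of_nat m - of_nat n) * virasoro N (m + n) f \<alpha>"
proof -
  obtain K0 where K0: "\<forall>K\<ge>K0. Poly_Mapping.keys \<alpha> \<subseteq> {..<K}" using keys_bounded by blast
  define K where "K = K0 + n"
  have K: "Poly_Mapping.keys \<alpha> \<subseteq> {..<K}" "Poly_Mapping.keys \<alpha> \<subseteq> {..<K0}" using K0 by (auto simp: K_def)
  define S where "S b = dT b (dT (m + n - 1 - b) f) \<alpha>" for b
  define T where "T k = mulT k (dT (k + m + n) f) \<alpha>" for k
  have dv: "dT k (virasoro N n g)
      = (\<lambda>\<beta>. virasoro N n (dT k g) \<beta> + of_nat (2*k+1) / 2 * dT (k + n) g \<beta>)" for k g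
    by (rule ext) (rule dT_virasoro)
  \<comment> \<open>The cost of moving \<open>L_n\<close> past \<open>t_{2k+1}\<close>, as given by
    \<open>mulT_virasoro\<close>.\<close>
  define corr where "corr k = (if n \<le> k then of_nat (2*(k-n)+1) / 2 * T (k - n)
       else 1/2 * S (k + m))" for k
  have A: "mulT k (dT (k+m) (virasoro N n f)) \<alpha>
      = virasoro N n (mulT k (dT (k+m) f)) \<alpha> - corr k + of_nat (2*(k+m)+1) / 2 * T k" for k
  proof -
    have "S (k+m) = dT (n-1-k) (dT (k+m) f) \<alpha>" if "\<not> n \<le> k"
    proof -
      have "m + n - 1 - (k + m) = n - 1 - k" using that by simp
      then show ?thesis by (simp add: S_def dT_commute[of "k+m"])
    qed
    moreover have "T (k - n) = mulT (k - n) (dT (k+m) f) \<alpha>" if "n \<le> k"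
      using that by (simp add: T_def)
    ultimately show ?thesis
      unfolding dv mulT_linear mulT_virasoro by (simp add: corr_def T_def)
  qed
  have B: "dT a (dT (m-1-a) (virasoro N n f)) \<alpha> = virasoro N n (dT a (dT (m-1-a) f)) \<alpha>
     + of_nat (2*a+1) / 2 * S (a+n) + of_nat (2*(m-1-a)+1) / 2 * S ((m-1-a)+n)" if "a < m" for a
  proof -
    have "m + n - 1 - (a + n) = m - 1 - a" "m + n - 1 - ((m-1-a)+n) = a" using that by auto
    then show ?thesis
      unfolding dv dT_linear by (simp add: S_def dT_commute[of a "m - Suc a + n"])
  qed
  have B': "(\<Sum>a<m. dT a (dT (m-1-a) (virasoro N n f)) \<alpha>) = (\<Sum>a<m. virasoro N n (dT a (dT (m-1-a) f)) \<alpha>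
     + of_nat (2*a+1) / 2 * S (a+n) + of_nat (2*(m-1-a)+1) / 2 * S ((m-1-a)+n))"
    by (rule sum.cong[OF refl B]) simp
  have C: "virasoro N n (virasoro N m f) \<alpha> = 
     (1/2) * (\<Sum>k<K. of_nat (2*k+1) * virasoro N n (mulT k (dT (k+m) f)) \<alpha>)
   + (1/4) * (\<Sum>a<m. virasoro N n (dT a (dT (m - 1 - a) f)) \<alpha>)
   + (if m = 0 then (1/16 - N^2/4) * virasoro N n f \<alpha> else 0)"
  proof -
    have "virasoro N n (virasoro N m f) \<alpha> = virasoro N n (\<lambda>\<beta>.
     (1/2) * (\<Sum>k<K. of_nat (2*k+1) * mulT k (dT (k+m) f) \<beta>)
   + (1/4) * (\<Sum>a<m. dT a (dT (m - 1 - a) f) \<beta>)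
   + (if m = 0 then 1/16 - N^2/4 else 0) * f \<beta>) \<alpha>"
    proof (rule virasoro_local[OF K(2)])
      fix \<beta> :: "nat \<Rightarrow>\<^sub>0 nat" assume "Poly_Mapping.keys \<beta> \<subseteq> {..<K0+n}"
      then have b: "Poly_Mapping.keys \<beta> \<subseteq> {..<K}" by (simp add: K_def)
      show "virasoro N m f \<beta> = 1 / 2 * (\<Sum>k<K. of_nat (2*k+1) * mulT k (dT (k+m) f) \<beta>)
   + (1/4) * (\<Sum>a<m. dT a (dT (m - 1 - a) f) \<beta>)
   + (if m = 0 then 1/16 - N^2/4 else 0) * f \<beta>"
        unfolding virasoro_upto[OF b] by simp
    qed
    then show ?thesis
      by (simp only: virasoro_linear virasoro_sum) simp
  qed
  have D: "(\<Sum>k<K. of_nat (2*k+1) * corr k)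
     = (\<Sum>k<n. of_nat (2*k+1) / 2 * S (k+m)) + (\<Sum>k<K. of_nat (2*(k+n)+1) * of_nat (2*k+1) / 2 * T k)"
  proof -
    have split: "(\<Sum>k<K. g k) = (\<Sum>k<n. g k) + (\<Sum>k<K0. g (k+n))" for g :: "nat \<Rightarrow> complex"
      unfolding K_def by (induction K0) simp_all
    have "(\<Sum>k<K0. of_nat (2*(k+n)+1) * of_nat (2*k+1) / 2 * T k) = (\<Sum>k<K. of_nat (2*(k+n)+1) * of_nat (2*k+1) / 2 * T k)"
      by (rule sum.mono_neutral_left) (use K(2) in \<open>auto simp: K_def T_def intro!: mulT_outside\<close>)
    then show ?thesis
      unfolding split by (simp add: corr_def mult.assoc)
  qed
  have E: "(\<Sum>a<m. of_nat (2*(m-1-a)+1) / 2 * S ((m-1-a)+n)) = (\<Sum>a<m. of_nat (2*a+1) / 2 * S (a+n))"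
    using sum.nat_diff_reindex[of "\<lambda>a. of_nat (2*a+1) / 2 * S (a+n)" m] by simp
  have sym: "S a = S (m + n - 1 - a)" if "a < m + n" for a
    using that by (simp add: S_def dT_commute[of a])
  have F: "(\<Sum>k<K. of_nat (2*k+1) * (of_nat (2*(k+m)+1) / 2 * T k))
     - (\<Sum>k<K. of_nat (2*(k+n)+1) * of_nat (2*k+1) / 2 * T k)
     = (of_nat m - of_nat n) * (\<Sum>k<K. of_nat (2*k+1) * T k)"
    unfolding sum_subtractf[symmetric] sum_distrib_left
    by (rule sum.cong[OF refl]) (simp add: algebra_simps add_divide_distrib)
  have "virasoro N m (virasoro N n f) \<alpha> - virasoro N n (virasoro N m f) \<alpha>
     = 1/2 * (\<Sum>k<K. of_nat (2*k+1) * (of_nat (2*(k+m)+1) / 2 * T k - corr k))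
     + 1/4 * (\<Sum>a<m. of_nat (2*a+1) / 2 * S (a+n) + of_nat (2*(m-1-a)+1) / 2 * S ((m-1-a)+n))"
    unfolding virasoro_upto[OF K(1), of N m] A C B'
    by (simp add: sum.distrib sum_subtractf distrib_left right_diff_distrib)
  also have "\<dots> = 1/2 * ((of_nat m - of_nat n) * (\<Sum>k<K. of_nat (2*k+1) * T k))
     + 1/4 * ((\<Sum>k<m. of_nat (2*k+1) * S (k+n)) - (\<Sum>a<n. of_nat (2*a+1) * S (a+m)))"
    unfolding F[symmetric] sum.distrib E right_diff_distrib sum_subtractf D
    by (simp add: sum_divide_distrib[symmetric] algebra_simps)
  also have "\<dots> = (of_nat m - of_nat n) * virasoro N (m + n) f \<alpha>"
  proof -
    have V: "virasoro N (m + n) f \<alpha> = 1/2 * (\<Sum>k<K. of_nat (2*k+1) * T k) + 1/4 * (\<Sum>a<m+n. S a)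
        + (if m + n = 0 then (1/16 - N^2/4) * f \<alpha> else 0)"
      unfolding virasoro_upto[OF K(1)] by (simp add: T_def S_def add.assoc)
    have tri: "(\<Sum>k<m. of_nat (2*k+1) * S (k+n)) - (\<Sum>a<n. of_nat (2*a+1) * S (a+m))
       = (of_nat m - of_nat n) * (\<Sum>a<m+n. S a)"
      by (rule triangle_sum_symmetric) (rule sym)
    \<comment> \<open>The constant of \<open>L_0\<close> enters only for \<open>m + n = 0\<close>,
      where the factor \<open>m - n\<close> vanishes.\<close>
    show ?thesis unfolding tri V distrib_left by (cases "m + n = 0") auto
  qed
  finally show ?thesis .
qed


section \<open>Grading by odd weight; uniqueness and existence of solutions\<close>

lemma odd_weight_add: "odd_weight (\<alpha> + \<beta>) = odd_weight \<alpha> + odd_weight \<beta>"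
proof -
  have *: "odd_weight \<gamma> = (\<Sum>k\<in>A. (2*k+1) * lookp \<gamma> k)" if "finite A" "Poly_Mapping.keys \<gamma> \<subseteq> A" for \<gamma> A
    unfolding odd_weight_def by (rule sum.mono_neutral_left) (use that in \<open>auto simp: in_keys_iff\<close>)
  let ?A = "Poly_Mapping.keys \<alpha> \<union> Poly_Mapping.keys \<beta>"
  have "Poly_Mapping.keys (\<alpha> + \<beta>) \<subseteq> ?A" by (rule keys_add)
  then show ?thesis
    by (subst (1 2 3) *[of ?A]) (auto simp: lookup_add algebra_simps sum.distrib)
qed

lemma odd_weight_exp1 [simp]: "odd_weight (exp1 k) = 2*k+1"
  by (simp add: odd_weight_def)

lemma odd_weight_zero [simp]: "odd_weight 0 = 0"
  by (simp add: odd_weight_def)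

lemma odd_weight_eq_0: "odd_weight \<alpha> = 0 \<longleftrightarrow> \<alpha> = 0"
proof
  assume "odd_weight \<alpha> = 0"
  then have "\<forall>k\<in>Poly_Mapping.keys \<alpha>. lookp \<alpha> k = 0" by (auto simp: odd_weight_def)
  then show "\<alpha> = 0" by (intro poly_mapping_eqI) (auto simp: in_keys_iff)
qed simp

lemma exp1_decompose:
  assumes "k \<in> Poly_Mapping.keys \<alpha>"
  obtains \<beta> where "\<alpha> = \<beta> + exp1 k" "odd_weight \<alpha> = odd_weight \<beta> + 2*k+1"
proof -
  have "\<alpha> = \<alpha> - exp1 k + exp1 k" using assms by (subst exp1_diff_add) (auto simp: in_keys_iff)
  then show ?thesis using that odd_weight_add[of "\<alpha> - exp1 k" "exp1 k"] by auto
qed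

text \<open>\<open>L_m\<close> reads coefficients of weight exactly \<open>2*m\<close> higher,
  whereas \<open>dT m\<close> reads weight \<open>2*m+1\<close> higher. This gap of one drives every
  recursion on weight.\<close>

lemma virasoro_weight_local:
  assumes eq: "\<And>\<beta>. odd_weight \<beta> = odd_weight \<alpha> + 2*m \<Longrightarrow> f \<beta> = g \<beta>"
  shows "virasoro N m f \<alpha> = virasoro N m g \<alpha>"
proof -
  have k: "mulT k (dT (k + m) f) \<alpha> = mulT k (dT (k + m) g) \<alpha>" if k: "k \<in> Poly_Mapping.keys \<alpha>" for k
  proof -
    obtain \<beta> where "\<alpha> = \<beta> + exp1 k" "odd_weight \<alpha> = odd_weight \<beta> + 2*k+1"
      using exp1_decompose[OF k] .
    then have "f (\<alpha> - exp1 k + exp1 (k+m)) = g (\<alpha> - exp1 k + exp1 (k+m))"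
      by (intro eq) (simp add: odd_weight_add)
    then show ?thesis by (simp add: mulT_eq dT_eq)
  qed
  have a: "dT a (dT (m - 1 - a) f) \<alpha> = dT a (dT (m - 1 - a) g) \<alpha>" if "a < m" for a
  proof -
    have "f (\<alpha> + exp1 a + exp1 (m-1-a)) = g (\<alpha> + exp1 a + exp1 (m-1-a))"
      using that by (intro eq) (simp add: odd_weight_add)
    then show ?thesis by (simp add: dT_eq)
  qed
  have c: "f \<alpha> = g \<alpha>" if "m = 0" using that by (intro eq) simp
  show ?thesis unfolding virasoro_def using k a c by simp
qed

lemma BGW_solution_unique:
  assumes "is_BGW_solution N hbar Z" "is_BGW_solution N hbar Z'" "Z 0 = Z' 0"
  shows "Z = Z'"
proof
  fix \<alpha> show "Z \<alpha> = Z' \<alpha>"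
  proof (induction "odd_weight \<alpha>" arbitrary: \<alpha> rule: less_induct)
    case less
    show ?case
    proof (cases "\<alpha> = 0")
      case False
      then obtain m where "m \<in> Poly_Mapping.keys \<alpha>" by fastforce
      then obtain \<beta> where \<beta>: "\<alpha> = \<beta> + exp1 m" "odd_weight \<alpha> = odd_weight \<beta> + 2*m+1"
        using exp1_decompose by blast
      have "virasoro N m Z \<beta> = virasoro N m Z' \<beta>"
        by (rule virasoro_weight_local) (use less \<beta> in auto)
      then have "dT m Z \<beta> = dT m Z' \<beta>"
        using assms(1,2) by (metis is_BGW_solution_def)
      moreover have "of_nat (lookp \<beta> m + 1) \<noteq> (0::complex)" by (metis Suc_eq_plus1 of_nat_neq_0)
      ultimately show ?thesis by (simp only: dT_eq \<beta> mult_cancel_left) simp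
    qed (use assms in simp)
  qed
qed

lemma BGW_solution_scale:
  assumes "is_BGW_solution N hbar Z"
  shows "is_BGW_solution N hbar (\<lambda>\<alpha>. c * Z \<alpha>)"
proof -
  have "hbar * virasoro N m Z \<alpha> = dT m Z \<alpha>" for m \<alpha>
    using assms by (metis is_BGW_solution_def)
  then have "hbar * virasoro N m (\<lambda>\<alpha>. c * Z \<alpha>) \<alpha> = dT m (\<lambda>\<alpha>. c * Z \<alpha>) \<alpha>" for m \<alpha>
    by (simp add: dT_linear virasoro_linear mult.left_commute)
  then show ?thesis by (auto simp: is_BGW_solution_def)
qed

text \<open>Integrating the constraints weight by weight: each coefficient is read off from the equation
  indexed by the smallest variable of its monomial; the commutation relations then give
  the equations for the remaining variables.\<close>

primrec BGW_approx :: "complex \<Rightarrow> complex \<Rightarrow> nat \<Rightarrow> mser" where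
  "BGW_approx N hbar 0 = ms_one"
| "BGW_approx N hbar (Suc w) = (\<lambda>\<alpha>. if odd_weight \<alpha> = Suc w
     then let m = Min (Poly_Mapping.keys \<alpha>) in
        hbar * virasoro N m (BGW_approx N hbar w) (\<alpha> - exp1 m) / of_nat (lookp \<alpha> m)
     else BGW_approx N hbar w \<alpha>)"

text \<open>The limit of the approximations: from stage \<open>w\<close> on, coefficients of weight
  at most \<open>w\<close> no longer change.\<close>

definition BGW_series :: "complex \<Rightarrow> complex \<Rightarrow> mser" where
  "BGW_series N hbar \<alpha> = BGW_approx N hbar (odd_weight \<alpha>) \<alpha>"

lemma BGW_approx_eq: "odd_weight \<alpha> \<le> w \<Longrightarrow> BGW_approx N hbar w \<alpha> = BGW_series N hbar \<alpha>"
  by (induction w) (auto simp: BGW_series_def le_Suc_eq)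

lemma BGW_series_zero: "BGW_series N hbar 0 = 1"
  by (simp add: BGW_series_def ms_one_def)

lemma BGW_series_Min:
  assumes "\<beta> + exp1 m = \<alpha>" "m = Min (Poly_Mapping.keys \<alpha>)"
  shows "dT m (BGW_series N hbar) \<beta> = hbar * virasoro N m (BGW_series N hbar) \<beta>"
proof -
  have w: "odd_weight \<alpha> = Suc (odd_weight \<beta> + 2 * m)"
    using assms(1) by (auto simp: odd_weight_add)
  have \<beta>: "\<alpha> - exp1 m = \<beta>" and l: "lookp \<alpha> m = lookp \<beta> m + 1"
    using assms(1) by (auto simp: lookup_add)
  have "virasoro N m (BGW_approx N hbar (odd_weight \<beta> + 2 * m)) \<beta> = virasoro N m (BGW_series N hbar) \<beta>"
    by (rule virasoro_weight_local) (simp add: BGW_approx_eq)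
  then have "BGW_series N hbar \<alpha> = hbar * virasoro N m (BGW_series N hbar) \<beta> / of_nat (lookp \<beta> m + 1)"
    unfolding BGW_series_def[of _ _ \<alpha>] w by (simp add: w Let_def \<beta> l flip: assms(2))
  moreover have "of_nat (lookp \<beta> m + 1) \<noteq> (0::complex)" by (metis Suc_eq_plus1 of_nat_neq_0)
  ultimately show ?thesis by (simp add: dT_eq assms(1))
qed

text \<open>The measure is the weight of \<open>\<beta> + exp1 n\<close> minus one. If the smallest
  variable \<open>m\<close> of that monomial differs from \<open>n\<close>, it is split off
  \<open>\<beta>\<close>, the two derivatives are exchanged, and the equation for \<open>m\<close>,
  valid by construction, is transported to \<open>n\<close>.\<close>

lemma BGW_series_eq:
  "dT n (BGW_series N hbar) \<beta> = hbar * virasoro N n (BGW_series N hbar) \<beta>"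
proof (induction "odd_weight \<beta> + 2 * n" arbitrary: \<beta> n rule: less_induct)
  case less
  let ?Z = "BGW_series N hbar"
  define \<alpha> where "\<alpha> = \<beta> + exp1 n"
  define m where "m = Min (Poly_Mapping.keys \<alpha>)"
  have n: "n \<in> Poly_Mapping.keys \<alpha>" by (simp add: \<alpha>_def keys_add_exp1)
  then have m: "m \<in> Poly_Mapping.keys \<alpha>" unfolding m_def by (intro Min_in) auto
  show ?case
  proof (cases "m = n")
    case True
    show ?thesis
      by (rule BGW_series_Min[of \<beta> n \<alpha>]) (simp_all only: \<alpha>_def[symmetric] m_def[symmetric] True)
  next
    case False
    with m have "m \<in> Poly_Mapping.keys \<beta>" by (simp add: \<alpha>_def keys_add_exp1)
    then obtain \<gamma> where \<gamma>: "\<beta> = \<gamma> + exp1 m" "odd_weight \<beta> = odd_weight \<gamma> + 2*m+1"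
      using exp1_decompose by blast
    have IH: "dT k ?Z \<delta> = hbar * virasoro N k ?Z \<delta>" if "odd_weight \<delta> + 2 * k < odd_weight \<beta> + 2 * n" for k \<delta>
      using less that by blast
    \<comment> \<open>Splitting off \<open>m\<close> lowered the weight by \<open>2*m+1\<close>, so
      the induction hypothesis covers every constraint needed at \<open>\<gamma>\<close>, including
      the one for the index \<open>i + j\<close>.\<close>
    have swap: "dT j (virasoro N i ?Z) \<gamma> = hbar * virasoro N i (virasoro N j ?Z) \<gamma>
        + of_nat (2*j+1) / 2 * hbar * virasoro N (i + j) ?Z \<gamma>" if "i + j = m + n" for i j
    proof -
      have "virasoro N i (dT j ?Z) \<gamma> = virasoro N i (\<lambda>\<delta>. hbar * virasoro N j ?Z \<delta>) \<gamma>"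
        by (rule virasoro_weight_local, rule IH) (use \<gamma> that in auto)
      moreover have "dT (j + i) ?Z \<gamma> = hbar * virasoro N (j + i) ?Z \<gamma>"
        by (rule IH) (use \<gamma> that in auto)
      ultimately show ?thesis
        by (simp add: dT_virasoro virasoro_linear add.commute)
    qed
    have "dT m (dT n ?Z) \<gamma> = dT n (dT m ?Z) \<gamma>" by (simp add: dT_commute)
    also have "\<dots> = of_nat (lookp \<gamma> n + 1) * dT m ?Z (\<gamma> + exp1 n)" by (simp add: dT_eq[of n])
    also have "dT m ?Z (\<gamma> + exp1 n) = hbar * virasoro N m ?Z (\<gamma> + exp1 n)"
      by (rule BGW_series_Min[OF _ m_def]) (simp add: \<alpha>_def \<gamma> ac_simps)
    also have "of_nat (lookp \<gamma> n + 1) * \<dots> = hbar * dT n (virasoro N m ?Z) \<gamma>"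
      by (simp add: dT_eq[of n])
    \<comment> \<open>The commutator contributes \<open>(m - n) L_{m+n}\<close>, the two derivative
      corrections contribute \<open>(n - m) L_{m+n}\<close>, and they cancel.\<close>
    also have "\<dots> = hbar * dT m (virasoro N n ?Z) \<gamma>"
    proof -
      have "dT n (virasoro N m ?Z) \<gamma> - dT m (virasoro N n ?Z) \<gamma>
        = hbar * (virasoro N m (virasoro N n ?Z) \<gamma> - virasoro N n (virasoro N m ?Z) \<gamma>)
        + (of_nat n - of_nat m) * hbar * virasoro N (m + n) ?Z \<gamma>"
        unfolding swap[OF refl] swap[of n m, OF add.commute, unfolded add.commute[of n m]]
        by (simp add: field_simps)
      then show ?thesis by (simp add: virasoro_commutator algebra_simps)
    qed
    finally have "of_nat (lookp \<gamma> m + 1) * dT n ?Z \<beta> = of_nat (lookp \<gamma> m + 1) * (hbar * virasoro N n ?Z \<beta>)"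
      by (simp add: dT_eq[of m] \<gamma> mult.left_commute)
    moreover have "of_nat (lookp \<gamma> m + 1) \<noteq> (0::complex)" by (metis Suc_eq_plus1 of_nat_neq_0)
    ultimately show ?thesis by (simp only: mult_cancel_left) simp
  qed
qed

lemma BGW_series_solution: "is_BGW_solution N hbar (BGW_series N hbar)"
  unfolding is_BGW_solution_def by (intro allI ext) (simp only: BGW_series_eq)

section \<open>Finiteness of the index sets of convolutions and Miwa sums\<close>

lemma finite_bounded_exponents:
  assumes "finite A"
  shows "finite {\<beta> :: nat \<Rightarrow>\<^sub>0 nat. Poly_Mapping.keys \<beta> \<subseteq> A \<and> (\<forall>i. lookp \<beta> i \<le> n)}"
proof -
  have "finite {f. \<forall>i. (i \<in> A \<longrightarrow> f i \<in> {..n}) \<and> (i \<notin> A \<longrightarrow> f i = (0::nat))}"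
    using assms by (intro finite_set_of_finite_funs) auto
  then have "finite (lookp ` {\<beta>. Poly_Mapping.keys \<beta> \<subseteq> A \<and> (\<forall>i. lookp \<beta> i \<le> n)})"
    by (rule rev_finite_subset) (auto simp: in_keys_iff)
  then show ?thesis
    by (rule finite_imageD) (auto intro!: inj_onI poly_mapping_eqI)
qed

lemma lookup_le_tot_deg: "lookp \<beta> i \<le> tot_deg \<beta>"
proof (cases "i \<in> Poly_Mapping.keys \<beta>")
  case True
  then show ?thesis unfolding tot_deg_def by (intro member_le_sum) auto
qed (simp add: in_keys_iff)

text \<open>Makes the sum in \<open>ms_mult\<close> a genuine one; over an infinite set it would
  default to 0.\<close>

lemma finite_splits: "finite {p. fst p + snd p = (\<beta> :: nat \<Rightarrow>\<^sub>0 nat)}"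
proof -
  let ?B = "{\<gamma>. Poly_Mapping.keys \<gamma> \<subseteq> Poly_Mapping.keys \<beta> \<and> (\<forall>i. lookp \<gamma> i \<le> tot_deg \<beta>)}"
  have "p \<in> ?B \<times> ?B" if "fst p + snd p = \<beta>" for p
  proof -
    have l: "lookp (fst p) i \<le> lookp \<beta> i" "lookp (snd p) i \<le> lookp \<beta> i" for i
      by (auto simp: that[symmetric] lookup_add)
    then have "lookp (fst p) i \<le> tot_deg \<beta>" "lookp (snd p) i \<le> tot_deg \<beta>" for i
      using lookup_le_tot_deg[of \<beta> i] order_trans by blast+
    moreover have "Poly_Mapping.keys (fst p) \<subseteq> Poly_Mapping.keys \<beta>" "Poly_Mapping.keys (snd p) \<subseteq> Poly_Mapping.keys \<beta>"
      using that by (auto simp: in_keys_iff lookup_add)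
    ultimately show ?thesis by (simp add: mem_Times_iff)
  qed
  then have "{p. fst p + snd p = \<beta>} \<subseteq> ?B \<times> ?B" by blast
  then show ?thesis
    by (rule finite_subset) (intro finite_SigmaI finite_bounded_exponents; simp)
qed

lemma lookup_le_odd_weight: "(2*k+1) * lookp \<alpha> k \<le> odd_weight \<alpha>"
proof (cases "k \<in> Poly_Mapping.keys \<alpha>")
  case True
  then show ?thesis unfolding odd_weight_def
    by (intro member_le_sum[where f="\<lambda>k. (2*k+1) * lookp \<alpha> k"]) auto
qed (simp add: in_keys_iff)

lemma key_less_odd_weight: "k \<in> Poly_Mapping.keys \<alpha> \<Longrightarrow> 2 * k < odd_weight \<alpha>"
  using lookup_le_odd_weight[of k \<alpha>] by (cases "lookp \<alpha> k") (auto simp: in_keys_iff)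

text \<open>Makes the sum in \<open>miwa\<close> a genuine one.\<close>

lemma finite_odd_weight: "finite {\<alpha>. odd_weight \<alpha> = d}"
proof (rule finite_subset[OF _ finite_bounded_exponents[of "{..d}" d]])
  have "Poly_Mapping.keys \<alpha> \<subseteq> {..odd_weight \<alpha>} \<and> (\<forall>i. lookp \<alpha> i \<le> odd_weight \<alpha>)" for \<alpha>
  proof (intro conjI subsetI allI)
    fix k assume "k \<in> Poly_Mapping.keys \<alpha>"
    then show "k \<in> {..odd_weight \<alpha>}" using key_less_odd_weight[of k \<alpha>] by simp
  next
    fix i show "lookp \<alpha> i \<le> odd_weight \<alpha>" using lookup_le_odd_weight[of i \<alpha>] by simp
  qed
  then show "{\<alpha>. odd_weight \<alpha> = d} \<subseteq> {\<beta>. Poly_Mapping.keys \<beta> \<subseteq> {..d} \<and> (\<forall>i. lookp \<beta> i \<le> d)}"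
    by blast
qed simp

subsection \<open>Polynomials as finitely supported series\<close>

type_synonym mpol = "(nat \<Rightarrow>\<^sub>0 nat) \<Rightarrow>\<^sub>0 complex"

lemma lookup_mult_ms_mult: "lookp (p * q) \<beta> = ms_mult (lookp p) (lookp q) \<beta>" for p q :: mpol
proof -
  have "lookp (p * q) \<beta> = prod_fun (lookp p) (lookp q) \<beta>"
    by (simp add: times_poly_mapping.rep_eq)
  also have "\<dots> = (\<Sum>(a, b). lookp p a * lookp q b when \<beta> = a + b)"
    by (rule prod_fun_unfold_prod) auto
  also have "\<dots> = (\<Sum>(a, b)\<in>{p. fst p + snd p = \<beta>}. lookp p a * lookp q b when \<beta> = a + b)"
    by (rule Sum_any.expand_superset) (auto simp: finite_splits)
  also have "\<dots> = ms_mult (lookp p) (lookp q) \<beta>"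
    unfolding ms_mult_def by (rule sum.cong) (auto simp: when_def)
  finally show ?thesis .
qed

lemma lookup_one_ms_one: "lookp (1 :: mpol) = ms_one"
  by (rule ext) (auto simp: ms_one_def lookup_one when_def)

lemma lookup_power_ms_pow: "lookp (p ^ n) = ms_pow (lookp p) n" for p :: mpol
proof (induction n)
  case (Suc n)
  have "lookp (p * p ^ n) = ms_mult (lookp p) (lookp (p ^ n))"
    by (rule ext) (rule lookup_mult_ms_mult)
  then show ?case using Suc by simp
qed (simp add: lookup_one_ms_one)

lemma lookup_prod_list: "lookp (prod_list ps) = ms_prodl (map lookp ps)" for ps :: "mpol list"
proof (induction ps)
  case (Cons p ps)
  have "lookp (p * prod_list ps) = ms_mult (lookp p) (lookp (prod_list ps))"
    by (rule ext) (rule lookup_mult_ms_mult)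
  then show ?case using Cons by (simp add: ms_prodl_def)
qed (simp add: ms_prodl_def lookup_one_ms_one)

lemma mpol_induct [case_names zero single add]:
  fixes p :: mpol
  assumes "P 0" "\<And>a c. P (Poly_Mapping.single a c)" "\<And>p q. P p \<Longrightarrow> P q \<Longrightarrow> P (p + q)"
  shows "P p"
proof -
  have "P (\<Sum>a\<in>A. Poly_Mapping.single a (lookp p a))" if "finite A" for A
    using that by (induction A) (auto intro: assms)
  moreover have "(\<Sum>a\<in>Poly_Mapping.keys p. Poly_Mapping.single a (lookp p a)) = p"
    by (rule poly_mapping_eqI) (auto simp: lookup_sum lookup_single when_def in_keys_iff)
  ultimately show ?thesis using finite_keys by metis
qed

abbreviation Cst :: "complex \<Rightarrow> mpol" where "Cst c \<equiv> Poly_Mapping.single 0 c"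

abbreviation X :: "nat \<Rightarrow> mpol" where "X i \<equiv> Poly_Mapping.single (exp1 i) 1"

lemma lookup_single_mult:
  "lookp (Poly_Mapping.single a c * p) (a + \<beta>) = c * lookp p \<beta>" for p :: mpol
  by (induction p rule: mpol_induct)
     (auto simp: mult_single lookup_single when_def distrib_left lookup_add)

lemma lookup_Cst_mult: "lookp (Cst c * p) \<beta> = c * lookp p \<beta>"
  using lookup_single_mult[of 0] by simp

lemma Cst_mult: "Cst (a * b) = Cst a * Cst b"
  by (simp add: mult_single)

lemma Cst_inverse_of_nat: "n \<noteq> 0 \<Longrightarrow> Cst (1 / of_nat n) * (of_nat n * p) = p"
  using Cst_mult[of "1 / of_nat n" "of_nat n"] by (simp flip: mult.assoc)

lemma lookup_X_mult:
  "lookp (X i * p) \<beta> = (if Suc 0 \<le> lookp \<beta> i then lookp p (\<beta> - exp1 i) else 0)"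
proof (cases "Suc 0 \<le> lookp \<beta> i")
  case True
  have "exp1 i + (\<beta> - exp1 i) = \<beta>" using exp1_diff_add[OF True] by (simp add: add.commute)
  then show ?thesis using True lookup_single_mult[of "exp1 i" 1 p "\<beta> - exp1 i"] by simp
next
  case False
  then have "exp1 i + a \<noteq> \<beta>" for a by (auto simp: lookup_add)
  then have "lookp (X i * p) \<beta> = 0"
    by (induction p rule: mpol_induct) (auto simp: mult_single lookup_single when_def distrib_left lookup_add)
  then show ?thesis using False by simp
qed

definition dX :: "nat \<Rightarrow> mpol \<Rightarrow> mpol" where
  "dX i p = Abs_poly_mapping (\<lambda>\<beta>. of_nat (lookp \<beta> i + 1) * lookp p (\<beta> + exp1 i))"

lemma lookup_dX: "lookp (dX i p) \<beta> = of_nat (lookp \<beta> i + 1) * lookp p (\<beta> + exp1 i)"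
proof -
  have "finite ((\<lambda>\<beta>. \<beta> + exp1 i) -` Poly_Mapping.keys p)"
    by (intro finite_vimageI) (auto intro: injI)
  then have "finite {\<beta>. of_nat (lookp \<beta> i + 1) * lookp p (\<beta> + exp1 i) \<noteq> 0}"
    by (rule rev_finite_subset) (auto simp: in_keys_iff)
  then show ?thesis by (simp add: dX_def)
qed

lemma dX_add: "dX i (p + q) = dX i p + dX i q"
  by (rule poly_mapping_eqI) (simp add: lookup_dX lookup_add algebra_simps)

lemma dX_zero [simp]: "dX i 0 = 0"
  by (rule poly_mapping_eqI) (simp add: lookup_dX)

lemma dX_sum: "dX i (sum f A) = (\<Sum>x\<in>A. dX i (f x))"
  by (induction A rule: infinite_finite_induct) (auto simp: dX_add)

lemma dX_single: "dX i (Poly_Mapping.single a c) = Poly_Mapping.single (a - exp1 i) (of_nat (lookp a i) * c)"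
proof (rule poly_mapping_eqI)
  fix \<beta>
  show "lookp (dX i (Poly_Mapping.single a c)) \<beta> = lookp (Poly_Mapping.single (a - exp1 i) (of_nat (lookp a i) * c)) \<beta>"
  proof (cases "Suc 0 \<le> lookp a i")
    case True
    have "a = \<beta> + exp1 i \<longleftrightarrow> a - exp1 i = \<beta>" using exp1_diff_add[OF True] by auto
    then show ?thesis using True
      by (auto simp: lookup_dX lookup_single when_def lookup_minus of_nat_diff)
  next
    case False
    then have "a \<noteq> \<beta> + exp1 i" by (auto simp: lookup_add)
    then show ?thesis using False by (auto simp: lookup_dX lookup_single when_def)
  qed
qed

lemma dX_mult: "dX i (p * q) = dX i p * q + p * dX i q"
proof (induction p rule: mpol_induct)
  case (single a c)
  show ?case
  proof (induction q rule: mpol_induct)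
    case (single b d)
    have 1: "a + b - exp1 i = a - exp1 i + b" if "lookp a i > 0"
      using that by (intro exp1_add_diff) simp
    have 2: "a + b - exp1 i = a + (b - exp1 i)" if "lookp b i > 0"
      using that exp1_add_diff[of b i a] by (simp add: add.commute)
    show ?case
      using 1 2 by (cases "lookp a i = 0"; cases "lookp b i = 0")
        (auto simp: mult_single dX_single lookup_add algebra_simps single_add)
  qed (auto simp: distrib_left dX_add algebra_simps)
qed (auto simp: distrib_right dX_add algebra_simps)

lemma dX_Cst [simp]: "dX i (Cst c) = 0" by (simp add: dX_single)

lemma dX_one [simp]: "dX i 1 = 0" using dX_Cst[of i 1] by simp

lemma dX_X: "dX i (X j) = (if i = j then 1 else 0)"
  by (simp add: dX_single lookup_single)

lemma dX_power: "dX i (p ^ n) = of_nat n * p ^ (n - 1) * dX i p"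
proof (induction n)
  case (Suc n)
  then show ?case by (cases n) (simp_all add: dX_mult algebra_simps)
qed simp

lemma X_power: "X i ^ n = Poly_Mapping.single (Poly_Mapping.single i n) 1"
  by (induction n) (simp_all add: mult_single single_add[symmetric])

subsection \<open>The Miwa substitution\<close>

definition psum :: "nat \<Rightarrow> nat \<Rightarrow> mpol" where "psum M n = (\<Sum>i<M. X i ^ n)"

definition miwa_pol :: "nat \<Rightarrow> nat \<Rightarrow> mpol" where
  "miwa_pol M k = Cst (1 / of_nat (2*k+1)) * psum M (2*k+1)"

definition miwa_mon :: "nat \<Rightarrow> (nat \<Rightarrow>\<^sub>0 nat) \<Rightarrow> mpol" where
  "miwa_mon M \<alpha> = (\<Prod>k\<in>Poly_Mapping.keys \<alpha>. miwa_pol M k ^ lookp \<alpha> k)"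

lemma single_inj: "Poly_Mapping.single i (Suc n) = Poly_Mapping.single j (Suc n) \<longleftrightarrow> i = j"
  by (metis keys_single nat.distinct(1) singleton_inject)

lemma lookup_miwa_pol: "lookp (miwa_pol M k) = miwa_t M k"
proof
  fix \<beta>
  have "lookp (psum M (2*k+1)) \<beta> = (if \<exists>i<M. \<beta> = Poly_Mapping.single i (2*k+1) then 1 else 0)"
  proof (cases "\<exists>i<M. \<beta> = Poly_Mapping.single i (2*k+1)")
    case True
    then obtain j where j: "j < M" "\<beta> = Poly_Mapping.single j (2*k+1)" by blast
    have "lookp (psum M (2*k+1)) \<beta> = (\<Sum>i<M. if i = j then 1 else 0)"
      unfolding psum_def X_power lookup_sum
      by (rule sum.cong) (auto simp: j lookup_single when_def single_inj)
    also have "\<dots> = 1" using j by simp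
    finally show ?thesis using True by simp
  next
    case False
    then have "lookp (psum M (2*k+1)) \<beta> = (\<Sum>i<M. 0)"
      unfolding psum_def X_power lookup_sum
      by (intro sum.cong) (auto simp: lookup_single when_def)
    then show ?thesis using False by simp
  qed
  then show "lookp (miwa_pol M k) \<beta> = miwa_t M k \<beta>"
    by (auto simp: miwa_pol_def miwa_t_def lookup_Cst_mult)
qed

lemma lookup_miwa_mon: "lookp (miwa_mon M \<alpha>) = miwa_monomial M \<alpha>"
proof -
  have "miwa_mon M \<alpha> = prod_list (map (\<lambda>k. miwa_pol M k ^ lookp \<alpha> k) (sorted_list_of_set (Poly_Mapping.keys \<alpha>)))"
    unfolding miwa_mon_def by (simp add: prod.distinct_set_conv_list[symmetric])
  then show ?thesis
    by (simp add: miwa_monomial_def lookup_prod_list lookup_power_ms_pow lookup_miwa_pol o_def)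
qed

lemma miwa_mon_zero [simp]: "miwa_mon M 0 = 1"
  by (simp add: miwa_mon_def)

lemma miwa_mon_add_exp1: "miwa_mon M (\<alpha> + exp1 k) = miwa_pol M k * miwa_mon M \<alpha>"
proof -
  have *: "miwa_mon M \<gamma> = (\<Prod>j\<in>A. miwa_pol M j ^ lookp \<gamma> j)" if "finite A" "Poly_Mapping.keys \<gamma> \<subseteq> A" for \<gamma> A
    unfolding miwa_mon_def by (rule prod.mono_neutral_left) (use that in \<open>auto simp: in_keys_iff\<close>)
  let ?A = "insert k (Poly_Mapping.keys \<alpha>)"
  have "miwa_mon M (\<alpha> + exp1 k) = (\<Prod>j\<in>?A. miwa_pol M j ^ lookp \<alpha> j * (if j = k then miwa_pol M k else 1))"
    by (subst *[of ?A]) (auto simp: keys_add_exp1 lookup_add lookup_single when_def mult.commute intro!: prod.cong)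
  also have "\<dots> = miwa_mon M \<alpha> * miwa_pol M k"
    by (subst *[of ?A]) (auto simp: prod.distrib)
  finally show ?thesis by (simp add: mult.commute)
qed

lemma dX_psum: "dX i (psum M n) = (if i < M then of_nat n * X i ^ (n - 1) else 0)"
proof -
  have "dX i (psum M n) = (\<Sum>j<M. if i = j then of_nat n * X i ^ (n - 1) else 0)"
    unfolding psum_def dX_sum by (rule sum.cong) (auto simp: dX_power dX_X)
  then show ?thesis by simp
qed

lemma dX_miwa_pol: "dX i (miwa_pol M k) = (if i < M then X i ^ (2*k) else 0)"
  using Cst_inverse_of_nat[of "2*k+1" "X i ^ (2*k)"]
  by (simp add: miwa_pol_def dX_mult dX_psum del: of_nat_Suc)

text \<open>When \<^term>\<open>lookp \<alpha> k = 0\<close> the truncated exponent \<^term>\<open>\<alpha> - exp1 k\<close> is junk, but its coefficient vanishes.\<close>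

lemma dX_miwa_mon:
  assumes "finite A" "Poly_Mapping.keys \<alpha> \<subseteq> A" "i < M"
  shows "dX i (miwa_mon M \<alpha>) = (\<Sum>k\<in>A. of_nat (lookp \<alpha> k) * X i ^ (2*k) * miwa_mon M (\<alpha> - exp1 k))"
  using assms(2)
proof (induction "odd_weight \<alpha>" arbitrary: \<alpha> rule: less_induct)
  case less
  show ?case
  proof (cases "\<alpha> = 0")
    case False
    then obtain j where "j \<in> Poly_Mapping.keys \<alpha>" by fastforce
    then obtain \<beta> where \<beta>: "\<alpha> = \<beta> + exp1 j" "odd_weight \<alpha> = odd_weight \<beta> + 2*j+1"
      using exp1_decompose by blast
    have sub: "Poly_Mapping.keys \<beta> \<subseteq> A" "j \<in> A" using less(2) by (auto simp: \<beta> keys_add_exp1)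
    have "dX i (miwa_mon M \<alpha>) = X i ^ (2*j) * miwa_mon M \<beta>
       + (\<Sum>k\<in>A. miwa_pol M j * (of_nat (lookp \<beta> k) * X i ^ (2*k) * miwa_mon M (\<beta> - exp1 k)))"
      using less(1)[OF _ sub(1)] assms(3) \<beta>(2)
      by (simp add: \<beta>(1) miwa_mon_add_exp1 dX_mult dX_miwa_pol sum_distrib_left)
    also have "X i ^ (2*j) * miwa_mon M \<beta> = (\<Sum>k\<in>A. if k = j then X i ^ (2*k) * miwa_mon M \<beta> else 0)"
      using sub(2) assms(1) by simp
    also have "\<dots> + (\<Sum>k\<in>A. miwa_pol M j * (of_nat (lookp \<beta> k) * X i ^ (2*k) * miwa_mon M (\<beta> - exp1 k)))
      = (\<Sum>k\<in>A. of_nat (lookp \<alpha> k) * X i ^ (2*k) * miwa_mon M (\<alpha> - exp1 k))"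
      unfolding sum.distrib[symmetric]
    proof (rule sum.cong[OF refl])
      fix k assume "k \<in> A"
      have *: "of_nat (lookp \<beta> k) * miwa_mon M (\<alpha> - exp1 k)
          = of_nat (lookp \<beta> k) * (miwa_pol M j * miwa_mon M (\<beta> - exp1 k))"
      proof (cases "lookp \<beta> k = 0")
        case False
        then have "\<alpha> - exp1 k = \<beta> - exp1 k + exp1 j" unfolding \<beta> by (intro exp1_add_diff) simp
        then show ?thesis by (simp add: miwa_mon_add_exp1)
      qed simp
      have "lookp \<alpha> k = lookp \<beta> k + (if k = j then 1 else 0)"
        by (simp add: \<beta> lookup_add lookup_single)
      then show "(if k = j then X i ^ (2*k) * miwa_mon M \<beta> else 0)
          + miwa_pol M j * (of_nat (lookp \<beta> k) * X i ^ (2*k) * miwa_mon M (\<beta> - exp1 k))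
         = of_nat (lookp \<alpha> k) * X i ^ (2*k) * miwa_mon M (\<alpha> - exp1 k)"
        using * by (auto simp: \<beta>(1) algebra_simps)
    qed
    finally show ?thesis .
  qed simp
qed


text \<open>The homogeneous part of degree \<open>d\<close> of the Miwa image, as a polynomial. The
  degree is an integer so that shifts such as \<open>d - 2 * int k - 1\<close> are never truncated;
  parts of negative degree are zero.\<close>

definition miwa_part :: "nat \<Rightarrow> int \<Rightarrow> mser \<Rightarrow> mpol" where
  "miwa_part M d Z = (\<Sum>\<alpha>\<in>{\<alpha>. int (odd_weight \<alpha>) = d}. Cst (Z \<alpha>) * miwa_mon M \<alpha>)"

lemma finite_odd_weight_int: "finite {\<alpha>. int (odd_weight \<alpha>) = d}"
  by (rule finite_subset[OF _ finite_odd_weight[of "nat d"]]) auto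

lemma miwa_part_neg: "d < 0 \<Longrightarrow> miwa_part M d Z = 0"
  by (simp add: miwa_part_def)

lemma miwa_part_0: "miwa_part M 0 Z = Cst (Z 0)"
  by (simp add: miwa_part_def odd_weight_eq_0)

lemma miwa_part_cong:
  "(\<And>\<alpha>. int (odd_weight \<alpha>) = d \<Longrightarrow> Z \<alpha> = Z' \<alpha>) \<Longrightarrow> miwa_part M d Z = miwa_part M d Z'"
  unfolding miwa_part_def by (rule sum.cong) auto

lemma miwa_part_linear:
  "miwa_part M d (\<lambda>\<alpha>. f \<alpha> + g \<alpha>) = miwa_part M d f + miwa_part M d g"
  "miwa_part M d (\<lambda>\<alpha>. c * f \<alpha>) = Cst c * miwa_part M d f"
  by (simp_all add: miwa_part_def single_add distrib_right sum.distrib Cst_mult sum_distrib_left mult.assoc)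

lemma miwa_part_sum: "miwa_part M d (\<lambda>\<alpha>. \<Sum>i\<in>I. h i \<alpha>) = (\<Sum>i\<in>I. miwa_part M d (h i))"
proof (induction I rule: infinite_finite_induct)
  case (insert x F)
  then show ?case by (simp add: miwa_part_linear(1))
qed (simp_all add: miwa_part_def)

text \<open>Reindexing by division by \<open>t_{2k+1}\<close>, for summands supported on monomials
  that contain this variable.\<close>

lemma sum_weight_shift:
  fixes g :: "_ \<Rightarrow> mpol"
  assumes "\<And>\<alpha>. lookp \<alpha> k = 0 \<Longrightarrow> g \<alpha> = 0"
  shows "(\<Sum>\<alpha>\<in>{\<alpha>. int (odd_weight \<alpha>) = d}. g \<alpha>)
       = (\<Sum>\<alpha>\<in>{\<alpha>. int (odd_weight \<alpha>) = d - 2 * int k - 1}. g (\<alpha> + exp1 k))"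
proof -
  let ?A = "{\<alpha>. int (odd_weight \<alpha>) = d - 2 * int k - 1}"
  have sub: "(\<lambda>\<alpha>. \<alpha> + exp1 k) ` ?A \<subseteq> {\<alpha>. int (odd_weight \<alpha>) = d}"
    by (auto simp: odd_weight_add)
  have "(\<Sum>\<alpha>\<in>(\<lambda>\<alpha>. \<alpha> + exp1 k) ` ?A. g \<alpha>) = (\<Sum>\<alpha>\<in>{\<alpha>. int (odd_weight \<alpha>) = d}. g \<alpha>)"
  proof (rule sum.mono_neutral_left[OF finite_odd_weight_int sub], intro ballI assms)
    fix \<alpha> assume \<alpha>: "\<alpha> \<in> {\<alpha>. int (odd_weight \<alpha>) = d} - (\<lambda>\<alpha>. \<alpha> + exp1 k) ` ?A"
    show "lookp \<alpha> k = 0"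
    proof (rule ccontr)
      assume "lookp \<alpha> k \<noteq> 0"
      then have "k \<in> Poly_Mapping.keys \<alpha>" by (simp add: in_keys_iff)
      then obtain \<beta> where "\<alpha> = \<beta> + exp1 k" "odd_weight \<alpha> = odd_weight \<beta> + 2*k+1"
        using exp1_decompose by blast
      then show False using \<alpha> by auto
    qed
  qed
  then show ?thesis
    by (subst (asm) sum.reindex) (auto intro!: inj_onI)
qed

lemma miwa_part_mulT:
  "of_nat (2*k+1) * miwa_part M d (mulT k Z) = psum M (2*k+1) * miwa_part M (d - 2 * int k - 1) Z"
proof -
  have "miwa_part M d (mulT k Z) = miwa_pol M k * miwa_part M (d - 2 * int k - 1) Z"
    unfolding miwa_part_def
    by (subst sum_weight_shift[of k])
       (auto simp: mulT_eq miwa_mon_add_exp1 lookup_add sum_distrib_left ac_simps intro!: sum.cong)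
  moreover have "of_nat (2*k+1) * miwa_pol M k = psum M (2*k+1)"
    using Cst_inverse_of_nat[of "2*k+1" "psum M (2*k+1)"]
    by (simp add: miwa_pol_def mult.left_commute del: of_nat_Suc)
  ultimately show ?thesis by (metis mult.assoc)
qed

text \<open>The chain rule with \<open>\<partial>t_{2k+1}/\<partial>x_i = x_i^{2k}\<close>.
  Monomials of weight \<open>d\<close> involve only variables with \<open>2*k < d\<close>, so the
  cutoff \<open>K\<close> loses nothing.\<close>

lemma dX_miwa_part:
  assumes "i < M" "d \<le> 2 * int K"
  shows "dX i (miwa_part M d Z) = (\<Sum>k<K. X i ^ (2*k) * miwa_part M (d - 2 * int k - 1) (dT k Z))"
proof -
  have K: "Poly_Mapping.keys \<alpha> \<subseteq> {..<K}" if "int (odd_weight \<alpha>) = d" for \<alpha>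
    using that assms(2) key_less_odd_weight[of _ \<alpha>] by fastforce
  have "dX i (miwa_part M d Z)
     = (\<Sum>\<alpha>\<in>{\<alpha>. int (odd_weight \<alpha>) = d}. \<Sum>k<K. Cst (Z \<alpha>) * (of_nat (lookp \<alpha> k) * X i ^ (2*k) * miwa_mon M (\<alpha> - exp1 k)))"
    unfolding miwa_part_def dX_sum
    by (intro sum.cong refl) (simp add: dX_mult dX_miwa_mon[OF finite_lessThan K assms(1)] sum_distrib_left)
  also have "\<dots> = (\<Sum>k<K. X i ^ (2*k) * miwa_part M (d - 2 * int k - 1) (dT k Z))"
  proof (subst sum.swap, rule sum.cong[OF refl])
    fix k
    show "(\<Sum>\<alpha>\<in>{\<alpha>. int (odd_weight \<alpha>) = d}. Cst (Z \<alpha>) * (of_nat (lookp \<alpha> k) * X i ^ (2*k) * miwa_mon M (\<alpha> - exp1 k)))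
       = X i ^ (2*k) * miwa_part M (d - 2 * int k - 1) (dT k Z)"
      unfolding miwa_part_def sum_distrib_left
    proof (subst sum_weight_shift[of k], simp, rule sum.cong[OF refl])
      fix \<alpha>
      have "Cst (dT k Z \<alpha>) = of_nat (lookp \<alpha> k + 1) * Cst (Z (\<alpha> + exp1 k))"
        unfolding dT_def Cst_mult single_of_nat One_nat_def ..
      then show "Cst (Z (\<alpha> + exp1 k)) * (of_nat (lookp (\<alpha> + exp1 k) k) * X i ^ (2*k) * miwa_mon M (\<alpha> + exp1 k - exp1 k))
         = X i ^ (2*k) * (Cst (dT k Z \<alpha>) * miwa_mon M \<alpha>)"
        by (simp add: lookup_add ac_simps)
    qed
  qed
  finally show ?thesis .
qed

lemma miwa_part_virasoro:
  assumes "d \<le> 2 * int K"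
  shows "4 * miwa_part M d (virasoro N m Z)
    = 2 * (\<Sum>k<K. psum M (2*k+1) * miwa_part M (d - 2 * int k - 1) (dT (k+m) Z))
    + (\<Sum>a<m. miwa_part M d (dT a (dT (m - 1 - a) Z)))
    + (if m = 0 then Cst (1/4 - N^2) * miwa_part M d Z else 0)"
proof -
  have K: "Poly_Mapping.keys \<alpha> \<subseteq> {..<K}" if "int (odd_weight \<alpha>) = d" for \<alpha>
    using that assms key_less_odd_weight[of _ \<alpha>] by fastforce
  have "4 * miwa_part M d (virasoro N m Z) = miwa_part M d (\<lambda>\<alpha>. 4 * virasoro N m Z \<alpha>)"
    by (simp add: miwa_part_linear)
  also have "\<dots> = miwa_part M d (\<lambda>\<alpha>. 2 * (\<Sum>k<K. of_nat (2*k+1) * mulT k (dT (k+m) Z) \<alpha>)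
     + (\<Sum>a<m. dT a (dT (m - 1 - a) Z) \<alpha>) + (if m = 0 then 1/4 - N^2 else 0) * Z \<alpha>)"
    by (rule miwa_part_cong) (simp add: virasoro_upto[OF K] algebra_simps)
  also have "\<dots> = 2 * (\<Sum>k<K. of_nat (2*k+1) * miwa_part M d (mulT k (dT (k+m) Z)))
    + (\<Sum>a<m. miwa_part M d (dT a (dT (m - 1 - a) Z)))
    + (if m = 0 then Cst (1/4 - N^2) * miwa_part M d Z else 0)"
    unfolding miwa_part_linear miwa_part_sum single_of_nat by (simp del: of_nat_Suc)
  finally show ?thesis unfolding miwa_part_mulT .
qed

lemma tot_deg_add: "tot_deg (\<alpha> + \<beta>) = tot_deg \<alpha> + tot_deg \<beta>"
proof -
  have *: "tot_deg \<gamma> = (\<Sum>k\<in>A. lookp \<gamma> k)" if "finite A" "Poly_Mapping.keys \<gamma> \<subseteq> A" for \<gamma> A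
    unfolding tot_deg_def by (rule sum.mono_neutral_left) (use that in \<open>auto simp: in_keys_iff\<close>)
  let ?A = "Poly_Mapping.keys \<alpha> \<union> Poly_Mapping.keys \<beta>"
  have "Poly_Mapping.keys (\<alpha> + \<beta>) \<subseteq> ?A" by (rule keys_add)
  then show ?thesis
    by (subst (1 2 3) *[of ?A]) (auto simp: lookup_add sum.distrib)
qed

lemma tot_deg_single [simp]: "tot_deg (Poly_Mapping.single i n) = n"
  by (simp add: tot_deg_def)

definition homogeneous :: "nat \<Rightarrow> mpol \<Rightarrow> bool" where
  "homogeneous d p \<longleftrightarrow> (\<forall>\<beta>\<in>Poly_Mapping.keys p. tot_deg \<beta> = d)"

lemma homogeneous_mult: "homogeneous c p \<Longrightarrow> homogeneous d q \<Longrightarrow> homogeneous (c + d) (p * q)"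
  using keys_mult[of p q] by (force simp: homogeneous_def tot_deg_add)

lemma homogeneous_power: "homogeneous c p \<Longrightarrow> homogeneous (c * n) (p ^ n)"
  by (induction n) (auto simp: homogeneous_mult, simp add: homogeneous_def tot_deg_def)

lemma homogeneous_add: "homogeneous d p \<Longrightarrow> homogeneous d q \<Longrightarrow> homogeneous d (p + q)"
  using keys_add[of p q] unfolding homogeneous_def by blast

lemma homogeneous_sum: "(\<And>x. x \<in> A \<Longrightarrow> homogeneous d (f x)) \<Longrightarrow> homogeneous d (sum f A)"
  by (induction A rule: infinite_finite_induct) (auto simp: homogeneous_add, simp_all add: homogeneous_def)

lemma homogeneous_miwa_pol: "homogeneous (2*k+1) (miwa_pol M k)"
proof -
  have "homogeneous (0 + (2*k+1)) (miwa_pol M k)"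
    unfolding miwa_pol_def psum_def X_power
    by (intro homogeneous_mult homogeneous_sum) (auto simp: homogeneous_def tot_deg_def)
  then show ?thesis by simp
qed

lemma homogeneous_miwa_mon: "homogeneous (odd_weight \<alpha>) (miwa_mon M \<alpha>)"
proof -
  have "homogeneous (\<Sum>k\<in>A. (2*k+1) * lookp \<alpha> k) (\<Prod>k\<in>A. miwa_pol M k ^ lookp \<alpha> k)" if "finite A" for A
    using that
  proof (induction A)
    case empty
    show ?case by (simp add: homogeneous_def tot_deg_def)
  next
    case (insert x F)
    show ?case
      unfolding sum.insert[OF insert(1,2)] prod.insert[OF insert(1,2)]
      by (intro homogeneous_mult homogeneous_power homogeneous_miwa_pol insert)
  qed
  then show ?thesis by (simp add: odd_weight_def miwa_mon_def)
qed

lemma lookup_miwa_part: "lookp (miwa_part M d Z) \<beta> = (if d = int (tot_deg \<beta>) then miwa M Z \<beta> else 0)"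
proof (cases "d = int (tot_deg \<beta>)")
  case True
  then show ?thesis
    unfolding miwa_part_def lookup_sum miwa_def lookup_Cst_mult lookup_miwa_mon by simp
next
  case False
  then have "lookp (miwa_mon M \<alpha>) \<beta> = 0" if "int (odd_weight \<alpha>) = d" for \<alpha>
    using homogeneous_miwa_mon[of \<alpha> M] that False by (metis homogeneous_def in_keys_iff)
  then show ?thesis using False
    by (simp add: miwa_part_def lookup_sum lookup_Cst_mult)
qed

text \<open>A polynomial stand-in for the whole Miwa image: a coefficient of a product at
  \<open>\<beta>\<close> sees only degrees up to \<open>tot_deg \<beta>\<close>.\<close>

definition miwa_trunc :: "nat \<Rightarrow> nat \<Rightarrow> mser \<Rightarrow> mpol" where
  "miwa_trunc M n Z = (\<Sum>d\<le>n. miwa_part M (int d) Z)"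

lemma lookup_miwa_trunc: "tot_deg \<beta> \<le> n \<Longrightarrow> lookp (miwa_trunc M n Z) \<beta> = miwa M Z \<beta>"
  by (simp add: miwa_trunc_def lookup_sum lookup_miwa_part)

lemma ms_mult_miwa:
  assumes "tot_deg \<beta> \<le> n"
  shows "ms_mult (miwa M Z) (lookp q) \<beta> = lookp (miwa_trunc M n Z * q) \<beta>"
  unfolding lookup_mult_ms_mult ms_mult_def
proof (rule sum.cong[OF refl])
  fix p assume "p \<in> {p. fst p + snd p = \<beta>}"
  then have "tot_deg (fst p) \<le> n" using assms by (auto simp: tot_deg_add)
  then show "miwa M Z (fst p) * lookp q (snd p) = lookp (miwa_trunc M n Z) (fst p) * lookp q (snd p)"
    by (simp add: lookup_miwa_trunc)
qed

subsection \<open>Euler operators\<close>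

definition euler :: "nat \<Rightarrow> mpol \<Rightarrow> mpol" where "euler i p = X i * dX i p"

lemma lookup_euler: "lookp (euler i p) \<beta> = of_nat (lookp \<beta> i) * lookp p \<beta>"
  by (auto simp: euler_def lookup_X_mult lookup_dX lookup_minus exp1_diff_add simp del: of_nat_Suc)

lemma euler_add: "euler i (p + q) = euler i p + euler i q"
  by (simp add: euler_def dX_add distrib_left)

lemma euler_sum: "euler i (sum f A) = (\<Sum>x\<in>A. euler i (f x))"
  by (simp add: euler_def dX_sum sum_distrib_left)

lemma euler_mult: "euler i (p * q) = euler i p * q + p * euler i q"
  by (simp add: euler_def dX_mult algebra_simps)

lemma euler_X_power: "euler i (X i ^ n) = of_nat n * X i ^ n"
  unfolding euler_def dX_power dX_X by (cases n) (simp_all add: algebra_simps)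

text \<open>With \<open>\<theta> = x \<partial>\<close> the summand is
  \<open>\<theta>(\<theta> + 1) = x^2 \<partial>^2 + 2 x \<partial>\<close>, so every monomial is an
  eigenvector.\<close>

definition euler_sq :: "nat \<Rightarrow> mpol \<Rightarrow> mpol" where
  "euler_sq M p = (\<Sum>i<M. euler i (euler i p) + euler i p)"

lemma lookup_euler_sq:
  "lookp (euler_sq M p) \<beta> = (\<Sum>i<M. of_nat (lookp \<beta> i * (lookp \<beta> i + 1))) * lookp p \<beta>"
  by (simp add: euler_sq_def lookup_sum lookup_add lookup_euler sum_distrib_right sum_distrib_left algebra_simps)

lemma euler_sq_mult:
  "euler_sq M (p * q) = euler_sq M p * q + p * euler_sq M q + 2 * (\<Sum>i<M. euler i p * euler i q)"
  by (simp add: euler_sq_def euler_mult euler_add sum.distrib sum_distrib_left sum_distrib_right algebra_simps)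

definition translation :: "nat \<Rightarrow> mpol \<Rightarrow> mpol" where "translation M p = (\<Sum>i<M. dX i p)"

lemma translation_mult: "translation M (p * q) = translation M p * q + p * translation M q"
  by (simp add: translation_def dX_mult sum.distrib sum_distrib_left sum_distrib_right)

definition vander :: "nat \<Rightarrow> mpol" where "vander M = (\<Prod>j<M. \<Prod>i<j. X i - X j)"

text \<open>Logarithmic derivatives add up over a product.\<close>

lemma derivation_prod:
  fixes D :: "mpol \<Rightarrow> mpol"
  assumes mult: "\<And>p q. D (p * q) = D p * q + p * D q" and one: "D 1 = 0"
    and f: "\<And>x. x \<in> A \<Longrightarrow> D (f x) = f x * g x"
  shows "D (prod f A) = prod f A * sum g A"
  using f by (induction A rule: infinite_finite_induct) (auto simp: mult one algebra_simps)

lemma dX_diff: "dX i (p - q) = dX i p - dX i q"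
  using dX_add[of i "p - q" q] by simp

lemma euler_X: "euler i (X j) = (if i = j then X j else 0)"
  by (simp add: euler_def dX_X)

lemma euler_diff: "euler i (p - q) = euler i p - euler i q"
  using euler_add[of i "p - q" q] by simp

lemma translation_vander: "translation M (vander M) = 0"
proof -
  have one: "translation M 1 = 0" by (simp add: translation_def)
  have lin: "translation M (X i - X j) = 0" if "i < M" "j < M" for i j
    using that by (simp add: translation_def dX_diff dX_X sum_subtractf)
  have "translation M (\<Prod>i<j. X i - X j) = (\<Prod>i<j. X i - X j) * (\<Sum>i<j. 0)" if "j < M" for j
    by (rule derivation_prod[OF translation_mult one]) (use lin that in auto)
  then have "translation M (vander M) = vander M * (\<Sum>j<M. \<Sum>i<j. 0)"
    unfolding vander_def by (rule derivation_prod[OF translation_mult one, of "{..<M}" "\<lambda>j. \<Prod>i<j. X i - X j" "\<lambda>j. \<Sum>i<j. 0"]) auto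
  then show ?thesis by simp
qed

text \<open>The complete homogeneous symmetric polynomial of degree \<open>n\<close> in two
  variables, which is the quotient of \<open>x_i^{n+1} - x_j^{n+1}\<close> by
  \<open>x_i - x_j\<close>.\<close>

definition complete2 :: "nat \<Rightarrow> nat \<Rightarrow> nat \<Rightarrow> mpol" where
  "complete2 n i j = (\<Sum>a\<le>n. X i ^ a * X j ^ (n - a))"

definition pair_sum :: "nat \<Rightarrow> nat \<Rightarrow> mpol" where
  "pair_sum M n = (\<Sum>j<M. \<Sum>i<j. complete2 n i j)"

text \<open>The operator \<open>\<Sum>i x_i^{n+1} \<partial>_i\<close> is a derivation that sends
  \<open>x_i - x_j\<close> to \<open>x_i^{n+1} - x_j^{n+1}\<close>, a multiple of
  \<open>x_i - x_j\<close>. Hence \<open>pair_sum\<close> is the logarithmic derivative of the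
  Vandermonde product along it.\<close>

lemma euler_vander: "(\<Sum>i<M. X i ^ n * euler i (vander M)) = vander M * pair_sum M n"
proof -
  define D where "D p = (\<Sum>i<M. X i ^ n * euler i p)" for p
  have mult: "D (p * q) = D p * q + p * D q" for p q
    by (simp add: D_def euler_mult sum.distrib sum_distrib_left sum_distrib_right algebra_simps)
  have one: "D 1 = 0" by (simp add: D_def euler_def)
  have DX: "D (X i) = X i ^ Suc n" if "i < M" for i
    using that by (simp add: D_def euler_X if_distrib mult.commute cong: if_cong)
  have lin: "D (X i - X j) = (X i - X j) * complete2 n i j" if "i < M" "j < M" for i j
  proof -
    have "D (X i - X j) = X i ^ Suc n - X j ^ Suc n"
      using DX[OF that(1)] DX[OF that(2)] by (simp add: D_def euler_diff right_diff_distrib sum_subtractf)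
    also have "\<dots> = (X i - X j) * complete2 n i j"
      unfolding power_diff_sumr2 complete2_def lessThan_Suc_atMost by (simp add: mult.commute)
    finally show ?thesis .
  qed
  have "D (\<Prod>i<j. X i - X j) = (\<Prod>i<j. X i - X j) * (\<Sum>i<j. complete2 n i j)" if "j < M" for j
    by (rule derivation_prod[OF mult one], rule lin) (use that in auto)
  then have "D (vander M) = vander M * pair_sum M n"
    unfolding vander_def pair_sum_def by (rule derivation_prod[OF mult one]) auto
  then show ?thesis by (simp add: D_def)
qed

lemma sum_square_pairs:
  fixes g :: "nat \<Rightarrow> nat \<Rightarrow> 'a::comm_monoid_add"
  shows "(\<Sum>i<M. \<Sum>j<M. g i j) = (\<Sum>i<M. g i i) + (\<Sum>j<M. \<Sum>i<j. g i j + g j i)"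
  by (induction M) (simp_all add: sum.distrib ac_simps)

lemma sum_even_odd:
  fixes f :: "nat \<Rightarrow> 'a::comm_monoid_add"
  shows "(\<Sum>a\<le>2*n+1. f a) = (\<Sum>k\<le>n. f (2*k+1)) + (\<Sum>k\<le>n. f (2*k))"
  by (induction n) (simp_all add: ac_simps)

text \<open>The products are expanded over pairs of variables. Each diagonal pair gives
  \<open>n + 1\<close> copies of \<open>x_i^{2n+1}\<close>. For \<open>i < j\<close> one order of
  the pair supplies the odd powers of \<open>x_i\<close> and the other the even ones, together all
  of \<open>complete2 (2*n+1) i j\<close>.\<close>

lemma psum_convolution:
  "of_nat (n + 1) * psum M (2*n+1) + pair_sum M (2*n+1) = (\<Sum>k\<le>n. psum M (2*k+1) * psum M (2*(n-k)))"
proof -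
  define g where "g i j = (\<Sum>k\<le>n. X i ^ (2*k+1) * X j ^ (2*(n-k)))" for i j
  have "(\<Sum>k\<le>n. psum M (2*k+1) * psum M (2*(n-k))) = (\<Sum>k\<le>n. \<Sum>i<M. \<Sum>j<M. X i ^ (2*k+1) * X j ^ (2*(n-k)))"
    by (simp add: psum_def sum_product)
  also have "\<dots> = (\<Sum>i<M. \<Sum>j<M. g i j)"
    unfolding g_def by (subst sum.swap, rule sum.cong[OF refl], rule sum.swap)
  also have "\<dots> = (\<Sum>i<M. g i i) + (\<Sum>j<M. \<Sum>i<j. g i j + g j i)"
    by (rule sum_square_pairs)
  also have "(\<Sum>i<M. g i i) = of_nat (n + 1) * psum M (2*n+1)"
  proof -
    have "g i i = of_nat (n + 1) * X i ^ (2*n+1)" for i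
    proof -
      have "g i i = (\<Sum>k\<le>n. X i ^ (2*n+1))"
        unfolding g_def power_add[symmetric]
        by (intro sum.cong refl arg_cong[where f="\<lambda>m. X i ^ m"]) auto
      then show ?thesis by simp
    qed
    then show ?thesis by (simp add: psum_def sum_distrib_left del: of_nat_add)
  qed
  also have "(\<Sum>j<M. \<Sum>i<j. g i j + g j i) = pair_sum M (2*n+1)"
  proof -
    have "g i j + g j i = complete2 (2*n+1) i j" for i j
    proof -
      have "g j i = (\<Sum>k\<le>n. X j ^ (2*(n-k)+1) * X i ^ (2*(n-(n-k))))"
        unfolding g_def
        using sum.nat_diff_reindex[of "\<lambda>k. X j ^ (2*k+1) * X i ^ (2*(n-k))" "Suc n"]
        by (simp only: lessThan_Suc_atMost diff_Suc_Suc)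
      also have "\<dots> = (\<Sum>k\<le>n. X i ^ (2*k) * X j ^ (2*n+1-2*k))"
      proof (rule sum.cong[OF refl])
        fix k assume "k \<in> {..n}"
        then have "2*(n-k)+1 = 2*n+1-2*k" "2*(n-(n-k)) = 2*k" by auto
        then show "X j ^ (2*(n-k)+1) * X i ^ (2*(n-(n-k))) = X i ^ (2*k) * X j ^ (2*n+1-2*k)"
          by (simp only: mult.commute)
      qed
      finally show ?thesis
        unfolding complete2_def sum_even_odd by (simp add: g_def diff_mult_distrib2)
    qed
    then show ?thesis by (simp add: pair_sum_def)
  qed
  finally show ?thesis by simp
qed

lemma sum_triangle:
  fixes g :: "nat \<Rightarrow> nat \<Rightarrow> 'a::comm_monoid_add"
  assumes "\<And>i j. K \<le> i + j \<Longrightarrow> g i j = 0"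
  shows "(\<Sum>i<K. \<Sum>j<K. g i j) = (\<Sum>n<K. \<Sum>i\<le>n. g i (n - i))"
proof -
  have "(\<Sum>n<K. \<Sum>i\<le>n. g i (n - i)) = (\<Sum>(i, j)\<in>{(i, j). i + j < K}. g i j)"
    by (rule sum.triangle_reindex[symmetric])
  also have "\<dots> = (\<Sum>(i, j)\<in>{..<K} \<times> {..<K}. g i j)"
  proof (rule sum.mono_neutral_left)
    have "i + j < K" if "g i j \<noteq> 0" for i j using assms that leI by blast
    then show "\<forall>p\<in>{..<K} \<times> {..<K} - {(i, j). i + j < K}. (case p of (i, j) \<Rightarrow> g i j) = 0"
      by auto
  qed auto
  finally show ?thesis by (simp add: sum.cartesian_product)
qed

text \<open>Converts the index pattern \<open>a\<close>, \<open>m - 1 - a\<close> of the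
  second-order Virasoro terms into a free double sum, as in
  \<open>euler_sq_miwa_part\<close>.\<close>

lemma sum_triangle_pred:
  fixes g :: "nat \<Rightarrow> nat \<Rightarrow> 'a::comm_monoid_add"
  assumes "\<And>i j. K \<le> i + j + 1 \<Longrightarrow> g i j = 0"
  shows "(\<Sum>i<K. \<Sum>j<K. g i j) = (\<Sum>m<K. \<Sum>a<m. g a (m - 1 - a))"
proof (cases K)
  case (Suc L)
  have "(\<Sum>i<K. \<Sum>j<K. g i j) = (\<Sum>n<K. \<Sum>i\<le>n. g i (n - i))"
    by (rule sum_triangle) (use assms in auto)
  also have "\<dots> = (\<Sum>n<L. \<Sum>i\<le>n. g i (n - i))"
    using assms by (simp add: Suc)
  also have "\<dots> = (\<Sum>m<K. \<Sum>a<m. g a (m - 1 - a))"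
    unfolding Suc by (subst sum.lessThan_Suc_shift) (simp add: lessThan_Suc_atMost)
  finally show ?thesis .
qed simp

subsection \<open>The constraints in the Miwa variables\<close>

lemma euler_miwa_part:
  assumes "i < M" "d \<le> 2 * int K"
  shows "euler i (miwa_part M d Z) = (\<Sum>k<K. X i ^ (2*k+1) * miwa_part M (d - 2 * int k - 1) (dT k Z))"
  by (simp add: euler_def dX_miwa_part[OF assms] sum_distrib_left mult.assoc)

text \<open>The chain rule applied twice. The factor \<open>2*k+2\<close> is the exponent
  \<open>2*k+1\<close>, on which the outer Euler operator acts, plus 1 from the first-order term of
  \<open>euler_sq\<close>.\<close>

lemma euler_sq_miwa_part:
  assumes "d \<le> 2 * int K"
  shows "euler_sq M (miwa_part M d Z)
    = (\<Sum>k<K. of_nat (2*k+2) * psum M (2*k+1) * miwa_part M (d - 2 * int k - 1) (dT k Z))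
    + (\<Sum>k<K. \<Sum>l<K. psum M (2*(k+l+1)) * miwa_part M (d - 2 * int (k+l+1)) (dT k (dT l Z)))"
proof -
  define U where "U k = miwa_part M (d - 2 * int k - 1) (dT k Z)" for k
  define V where "V k l = miwa_part M (d - 2 * int (k+l+1)) (dT k (dT l Z))" for k l
  have e2: "euler i (U k) = (\<Sum>l<K. X i ^ (2*l+1) * V k l)" if "i < M" for i k
  proof -
    have "d - 2 * int k - 1 - 2 * int l - 1 = d - 2 * int (k+l+1)" for l by simp
    then show ?thesis
      unfolding U_def V_def using assms by (subst euler_miwa_part[OF that, of _ K]) (simp_all only: dT_commute[of k])
  qed
  have "euler i (euler i (miwa_part M d Z)) + euler i (miwa_part M d Z)
     = (\<Sum>k<K. of_nat (2*k+2) * X i ^ (2*k+1) * U k) + (\<Sum>k<K. \<Sum>l<K. X i ^ (2*(k+l+1)) * V k l)" if "i < M" for i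
  proof -
    have "euler i (X i ^ (2*k+1) * U k) + X i ^ (2*k+1) * U k
        = of_nat (2*k+2) * X i ^ (2*k+1) * U k + (\<Sum>l<K. X i ^ (2*(k+l+1)) * V k l)" for k
    proof -
      have "X i ^ (2*k+1) * (X i ^ (2*l+1) * V k l) = X i ^ (2*(k+l+1)) * V k l" for l
        by (simp add: power_add algebra_simps)
      then have "X i ^ (2*k+1) * (\<Sum>l<K. X i ^ (2*l+1) * V k l) = (\<Sum>l<K. X i ^ (2*(k+l+1)) * V k l)"
        by (simp only: sum_distrib_left)
      moreover have "euler i (X i ^ (2*k+1) * U k) + X i ^ (2*k+1) * U k
         = of_nat (2*k+2) * X i ^ (2*k+1) * U k + X i ^ (2*k+1) * (\<Sum>l<K. X i ^ (2*l+1) * V k l)"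
        unfolding euler_mult euler_X_power e2[OF that] by (simp add: algebra_simps)
      ultimately show ?thesis by simp
    qed
    then show ?thesis
      unfolding euler_miwa_part[OF that assms] U_def[symmetric] euler_sum sum.distrib[symmetric]
      by (rule sum.cong[OF refl])
  qed
  then have "euler_sq M (miwa_part M d Z)
     = (\<Sum>i<M. \<Sum>k<K. of_nat (2*k+2) * X i ^ (2*k+1) * U k) + (\<Sum>i<M. \<Sum>k<K. \<Sum>l<K. X i ^ (2*(k+l+1)) * V k l)"
    unfolding euler_sq_def by (simp only: sum.distrib[symmetric]) simp
  also have "(\<Sum>i<M. \<Sum>k<K. of_nat (2*k+2) * X i ^ (2*k+1) * U k) = (\<Sum>k<K. of_nat (2*k+2) * psum M (2*k+1) * U k)"
    by (subst sum.swap) (simp only: psum_def sum_distrib_left sum_distrib_right)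
  also have "(\<Sum>i<M. \<Sum>k<K. \<Sum>l<K. X i ^ (2*(k+l+1)) * V k l) = (\<Sum>k<K. \<Sum>l<K. psum M (2*(k+l+1)) * V k l)"
    by (subst sum.swap, rule sum.cong[OF refl], subst sum.swap) (simp only: psum_def sum_distrib_right)
  finally show ?thesis by (simp only: U_def V_def)
qed

text \<open>The source of the even power sums by which the constraints are weighted.\<close>

lemma translation_miwa_part:
  assumes "d \<le> 2 * int K"
  shows "translation M (miwa_part M d Z) = (\<Sum>k<K. psum M (2*k) * miwa_part M (d - 2 * int k - 1) (dT k Z))"
proof -
  have "translation M (miwa_part M d Z) = (\<Sum>i<M. \<Sum>k<K. X i ^ (2*k) * miwa_part M (d - 2 * int k - 1) (dT k Z))"
    unfolding translation_def by (rule sum.cong) (use assms in \<open>auto simp: dX_miwa_part\<close>)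
  also have "\<dots> = (\<Sum>k<K. psum M (2*k) * miwa_part M (d - 2 * int k - 1) (dT k Z))"
    by (subst sum.swap) (simp only: psum_def sum_distrib_right)
  finally show ?thesis .
qed

text \<open>The second-order terms already match those of \<open>euler_sq\<close>. The products of
  an even and an odd power sum are converted by \<open>psum_convolution\<close> into the first-order
  terms of \<open>euler_sq\<close> and the interaction \<open>pair_sum\<close>. The constant of
  \<open>L_0\<close> is multiplied by \<open>p_0 = M\<close>.\<close>

lemma virasoro_miwa_part:
  assumes "d < 2 * int K"
  shows "4 * (\<Sum>m<K. psum M (2*m) * miwa_part M (d - 2 * int m) (virasoro N m Z))
   = euler_sq M (miwa_part M d Z) + 2 * (\<Sum>k<K. pair_sum M (2*k+1) * miwa_part M (d - 2 * int k - 1) (dT k Z))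
     + of_nat M * Cst (1/4 - N^2) * miwa_part M d Z"
proof -
  define U where "U k = miwa_part M (d - 2 * int k - 1) (dT k Z)" for k
  define V where "V k l = miwa_part M (d - 2 * int (k+l+1)) (dT k (dT l Z))" for k l
  define c where "c = Cst (1/4 - N^2) * miwa_part M d Z"
  \<comment> \<open>Beyond the cutoff all degrees are negative, so the square sums may be reindexed
    as triangles.\<close>
  have U0: "U n = 0" if "K \<le> n" for n unfolding U_def by (rule miwa_part_neg) (use that assms in auto)
  have V0: "V k l = 0" if "K \<le> k + l + 1" for k l unfolding V_def by (rule miwa_part_neg) (use that assms in auto)
  \<comment> \<open>For \<open>K = 0\<close> the sum over \<open>m\<close> lacks the constant term,
    but then \<open>d\<close> is negative and the term is zero.\<close>
  have K0: "K > 0 \<or> miwa_part M d Z = 0" using assms by (cases K) (auto intro: miwa_part_neg)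
  have vir: "4 * miwa_part M (d - 2 * int m) (virasoro N m Z)
      = 2 * (\<Sum>k<K. psum M (2*k+1) * U (k+m)) + (\<Sum>a<m. V a (m-1-a)) + (if m = 0 then c else 0)" for m
  proof -
    have "miwa_part M (d - 2 * int m - 2 * int k - 1) (dT (k+m) Z) = U (k+m)" for k
      unfolding U_def by (rule arg_cong[where f="\<lambda>d. miwa_part M d (dT (k+m) Z)"]) simp
    moreover have "miwa_part M (d - 2 * int m) (dT a (dT (m-1-a) Z)) = V a (m-1-a)" if "a < m" for a
    proof -
      have "d - 2 * int m = d - 2 * int (a + (m-1-a) + 1)" using that by simp
      then show ?thesis unfolding V_def by simp
    qed
    ultimately show ?thesis
      unfolding c_def using assms by (subst miwa_part_virasoro[of _ K]) auto
  qed
  have "4 * (\<Sum>m<K. psum M (2*m) * miwa_part M (d - 2 * int m) (virasoro N m Z))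
     = (\<Sum>m<K. psum M (2*m) * (2 * (\<Sum>k<K. psum M (2*k+1) * U (k+m)) + (\<Sum>a<m. V a (m-1-a)) + (if m = 0 then c else 0)))"
    unfolding vir[symmetric] by (simp add: sum_distrib_left mult.left_commute)
  also have "\<dots> = 2 * (\<Sum>m<K. \<Sum>k<K. psum M (2*m) * psum M (2*k+1) * U (k+m))
     + (\<Sum>m<K. \<Sum>a<m. psum M (2*m) * V a (m-1-a)) + (\<Sum>m<K. if m = 0 then psum M 0 * c else 0)"
    unfolding distrib_left sum.distrib sum_distrib_left
    by (intro arg_cong2[where f="(+)"] sum.cong refl) (auto simp: algebra_simps)
  also have "(\<Sum>m<K. \<Sum>k<K. psum M (2*m) * psum M (2*k+1) * U (k+m))
     = (\<Sum>n<K. (\<Sum>k\<le>n. psum M (2*k+1) * psum M (2*(n-k))) * U n)"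
  proof -
    have "(\<Sum>m<K. \<Sum>k<K. psum M (2*m) * psum M (2*k+1) * U (k+m))
       = (\<Sum>k<K. \<Sum>m<K. psum M (2*k+1) * psum M (2*m) * U (k+m))"
      by (subst sum.swap) (simp only: ac_simps)
    also have "\<dots> = (\<Sum>n<K. \<Sum>k\<le>n. psum M (2*k+1) * psum M (2*(n-k)) * U (k + (n-k)))"
      by (rule sum_triangle) (simp add: U0)
    finally show ?thesis by (simp add: sum_distrib_right)
  qed
  also have "(\<Sum>m<K. \<Sum>a<m. psum M (2*m) * V a (m-1-a)) = (\<Sum>k<K. \<Sum>l<K. psum M (2*(k+l+1)) * V k l)"
    by (subst sum_triangle_pred) (auto simp: V0 intro!: sum.cong)
  also have "(\<Sum>m<K. if m = 0 then psum M 0 * c else 0) = of_nat M * c"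
    using K0 by (cases "K > 0") (auto simp: psum_def c_def)
  also have "2 * (\<Sum>n<K. (\<Sum>k\<le>n. psum M (2*k+1) * psum M (2*(n-k))) * U n)
     = (\<Sum>k<K. of_nat (2*k+2) * psum M (2*k+1) * U k) + 2 * (\<Sum>k<K. pair_sum M (2*k+1) * U k)"
    unfolding psum_convolution[symmetric] distrib_right sum.distrib distrib_left sum_distrib_left
    by (intro arg_cong2[where f="(+)"] sum.cong refl) (simp_all add: algebra_simps)
  finally show ?thesis
    using assms unfolding euler_sq_miwa_part[of d K, OF less_imp_le[OF assms]] U_def[symmetric] V_def[symmetric]
    by (simp add: c_def algebra_simps)
qed

text \<open>Multiplication by the Vandermonde product absorbs the interaction: by
  \<open>euler_vander\<close> it equals the cross term in the Leibniz rule for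
  \<open>euler_sq\<close>. Since \<open>translation\<close> lowers the degree by one, degree
  \<open>d + 1\<close> on the left meets degree \<open>d\<close> on the right.\<close>

lemma BGW_miwa_part:
  assumes "is_BGW_solution N hbar Z"
  shows "4 * translation M (vander M * miwa_part M (int d + 1) Z)
    = Cst hbar * (euler_sq M (vander M * miwa_part M (int d) Z) - euler_sq M (vander M) * miwa_part M (int d) Z
        + of_nat M * Cst (1/4 - N^2) * (vander M * miwa_part M (int d) Z))"
proof -
  define K where "K = d + 1"
  define U where "U = miwa_part M (int d) Z"
  define U1 where "U1 k = miwa_part M (int d - 2 * int k - 1) (dT k Z)" for k
  have sol: "Cst hbar * miwa_part M e (virasoro N m Z) = miwa_part M e (dT m Z)" for e m
    using assms by (simp add: is_BGW_solution_def flip: miwa_part_linear(2))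
  have "4 * translation M (vander M * miwa_part M (int d + 1) Z)
     = vander M * (4 * (\<Sum>m<K. psum M (2*m) * miwa_part M (int d - 2 * int m) (dT m Z)))"
    by (simp add: translation_mult translation_vander translation_miwa_part[of _ K] K_def algebra_simps del: sum.lessThan_Suc)
  also have "(\<Sum>m<K. psum M (2*m) * miwa_part M (int d - 2 * int m) (dT m Z))
     = Cst hbar * (\<Sum>m<K. psum M (2*m) * miwa_part M (int d - 2 * int m) (virasoro N m Z))"
    unfolding sol[symmetric] sum_distrib_left by (simp only: ac_simps)
  also have "4 * \<dots> = Cst hbar * (euler_sq M U + 2 * (\<Sum>k<K. pair_sum M (2*k+1) * U1 k)
     + of_nat M * Cst (1/4 - N^2) * U)"
    by (subst mult.left_commute, subst virasoro_miwa_part) (simp_all add: K_def U_def U1_def)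
  also have "vander M * \<dots> = Cst hbar * (vander M * euler_sq M U + 2 * (vander M * (\<Sum>k<K. pair_sum M (2*k+1) * U1 k))
        + of_nat M * Cst (1/4 - N^2) * (vander M * U))"
    by (simp add: algebra_simps)
  also have "vander M * (\<Sum>k<K. pair_sum M (2*k+1) * U1 k) = (\<Sum>i<M. euler i (vander M) * euler i U)"
  proof -
    have "(\<Sum>i<M. euler i (vander M) * euler i U) = (\<Sum>i<M. \<Sum>k<K. X i ^ (2*k+1) * euler i (vander M) * U1 k)"
      unfolding U_def U1_def
      by (rule sum.cong[OF refl])
        (subst euler_miwa_part[of _ _ _ K], auto simp: K_def sum_distrib_left ac_simps simp del: sum.lessThan_Suc power_Suc)
    also have "\<dots> = (\<Sum>k<K. (\<Sum>i<M. X i ^ (2*k+1) * euler i (vander M)) * U1 k)"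
      by (subst sum.swap) (simp only: sum_distrib_right)
    finally show ?thesis by (simp only: euler_vander sum_distrib_left mult.assoc)
  qed
  also have "vander M * euler_sq M U + 2 * (\<Sum>i<M. euler i (vander M) * euler i U)
      = euler_sq M (vander M * U) - euler_sq M (vander M) * U"
    by (simp add: euler_sq_mult)
  finally show ?thesis by (simp add: U_def)
qed

subsection \<open>Setting a variable to zero\<close>

definition kill :: "nat \<Rightarrow> mpol \<Rightarrow> mpol" where
  "kill i p = Abs_poly_mapping (\<lambda>\<beta>. if lookp \<beta> i = 0 then lookp p \<beta> else 0)"

lemma lookup_kill: "lookp (kill i p) \<beta> = (if lookp \<beta> i = 0 then lookp p \<beta> else 0)"
proof -
  have "finite {\<beta>. (if lookp \<beta> i = 0 then lookp p \<beta> else 0) \<noteq> 0}"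
    by (rule rev_finite_subset[OF finite_keys[of p]]) (auto simp: in_keys_iff split: if_splits)
  then show ?thesis by (simp add: kill_def)
qed

lemma kill_add: "kill i (p + q) = kill i p + kill i q"
  by (rule poly_mapping_eqI) (simp add: lookup_kill lookup_add)

lemma kill_diff: "kill i (p - q) = kill i p - kill i q"
  by (rule poly_mapping_eqI) (simp add: lookup_kill lookup_minus)

lemma kill_zero [simp]: "kill i 0 = 0"
  by (rule poly_mapping_eqI) (simp add: lookup_kill)

lemma kill_single: "kill i (Poly_Mapping.single a c) = (if lookp a i = 0 then Poly_Mapping.single a c else 0)"
  by (rule poly_mapping_eqI) (auto simp: lookup_kill lookup_single when_def)

lemma kill_mult: "kill i (p * q) = kill i p * kill i q"
proof (induction p rule: mpol_induct)
  case (single a c)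
  show ?case
    by (induction q rule: mpol_induct)
       (auto simp: mult_single kill_single lookup_add distrib_left kill_add)
qed (auto simp: distrib_right kill_add)

lemma kill_one [simp]: "kill i 1 = 1"
  using kill_single[of i 0 1] by simp

lemma kill_Cst [simp]: "kill i (Cst c) = Cst c"
  by (simp add: kill_single)

lemma kill_X: "kill i (X j) = (if i = j then 0 else X j)"
  by (simp add: kill_single lookup_single)

lemma kill_power: "kill i (p ^ n) = kill i p ^ n"
  by (induction n) (simp_all add: kill_mult)

lemma kill_sum: "kill i (sum f A) = (\<Sum>x\<in>A. kill i (f x))"
  by (induction A rule: infinite_finite_induct) (simp_all add: kill_add)

lemma kill_prod: "kill i (prod f A) = (\<Prod>x\<in>A. kill i (f x))"
  by (induction A rule: infinite_finite_induct) (simp_all add: kill_mult)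

lemma kill_psum:
  assumes "M \<le> i" shows "kill i (psum M n) = psum M n"
  unfolding psum_def kill_sum kill_power kill_X using assms by (intro sum.cong) auto

text \<open>A positive exponent is essential, because \<open>psum M 0\<close> counts the variables.
  The Miwa times involve only odd powers, so they are stable under setting the last variable to
  zero.\<close>

lemma kill_psum_Suc: "n > 0 \<Longrightarrow> kill M (psum (Suc M) n) = psum M n"
  using kill_psum[of M M n] by (simp add: psum_def kill_add kill_power kill_X)

lemma kill_miwa_part:
  assumes "M \<le> i" shows "kill i (miwa_part M d Z) = miwa_part M d Z"
  by (simp add: miwa_part_def miwa_mon_def miwa_pol_def kill_sum kill_mult kill_prod kill_power kill_psum[OF assms])

lemma kill_miwa_part_Suc: "kill M (miwa_part (Suc M) d Z) = miwa_part M d Z"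
  by (simp add: miwa_part_def miwa_mon_def miwa_pol_def kill_sum kill_mult kill_prod kill_power kill_psum_Suc)

lemma vander_Suc: "vander (Suc M) = vander M * (\<Prod>i<M. X i - X M)"
  by (simp add: vander_def)

lemma kill_vander: "M \<le> i \<Longrightarrow> kill i (vander M) = vander M"
  unfolding vander_def kill_prod kill_diff kill_X by (intro prod.cong) auto

definition ones :: "nat \<Rightarrow> nat \<Rightarrow>\<^sub>0 nat" where "ones M = (\<Sum>i<M. exp1 i)"

lemma lookup_ones: "lookp (ones M) i = (if i < M then 1 else 0)"
  by (simp add: ones_def lookup_sum lookup_single when_def)

lemma prod_X: "(\<Prod>i<M. X i) = Poly_Mapping.single (ones M) 1"
  by (induction M) (simp_all add: ones_def mult_single add.commute)

lemma kill_vander_Suc: "kill M (vander (Suc M)) = Poly_Mapping.single (ones M) 1 * vander M"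
proof -
  have "kill M (\<Prod>i<M. X i - X M) = (\<Prod>i<M. X i)"
    unfolding kill_prod kill_diff kill_X by (intro prod.cong) auto
  then show ?thesis
    by (simp add: vander_Suc kill_mult kill_vander prod_X mult.commute)
qed

lemma lookup_single_mult_eq_0:
  "(\<And>\<gamma>. \<beta> \<noteq> a + \<gamma>) \<Longrightarrow> lookp (Poly_Mapping.single a c * p) \<beta> = 0" for p :: mpol
  by (induction p rule: mpol_induct) (auto simp: mult_single lookup_single when_def distrib_left lookup_add)

text \<open>Multiplication by \<open>x_0 ... x_{M-1}\<close> in coefficient form, see
  \<open>lookup_ones_mult\<close>. This monomial is what the new Vandermonde factors become at
  \<open>x_M = 0\<close>.\<close>

definition unshift :: "nat \<Rightarrow> mser \<Rightarrow> mser" where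
  "unshift M f \<gamma> = (if \<forall>i<M. 1 \<le> lookp \<gamma> i then f (\<gamma> - ones M) else 0)"

lemma lookup_ones_mult: "lookp (Poly_Mapping.single (ones M) 1 * p) \<gamma> = unshift M (lookp p) \<gamma>" for p :: mpol
proof (cases "\<forall>i<M. 1 \<le> lookp \<gamma> i")
  case True
  then have "\<gamma> = ones M + (\<gamma> - ones M)"
    by (intro poly_mapping_eqI) (auto simp: lookup_add lookup_minus lookup_ones)
  then show ?thesis using True lookup_single_mult[of "ones M" 1 p "\<gamma> - ones M"] by (simp add: unshift_def)
next
  case False
  then have "lookp (Poly_Mapping.single (ones M) 1 * p) \<gamma> = 0"
    by (intro lookup_single_mult_eq_0) (auto simp: lookup_add lookup_ones)
  then show ?thesis using False by (auto simp: unshift_def)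
qed

subsection \<open>Uniqueness of a stable family\<close>

text \<open>Read coefficientwise, the recursion is the equation
  \<open>\<Sum>\<^sub>i \<partial>\<^sub>i f = hbar / 4 (\<Sum>\<^sub>i (x\<^sub>i\<^sup>2 \<partial>\<^sub>i\<^sup>2 + 2 x\<^sub>i \<partial>\<^sub>i + 1/4 - N\<^sup>2) - \<kappa>) f\<close>, where \<open>\<kappa>\<close> is the
  eigenvalue of \<open>\<Sum>\<^sub>i (x\<^sub>i\<^sup>2 \<partial>\<^sub>i\<^sup>2 + 2 x\<^sub>i \<partial>\<^sub>i)\<close> on the Vandermonde product.\<close>

definition BGW_recursion :: "complex \<Rightarrow> complex \<Rightarrow> nat \<Rightarrow> mser \<Rightarrow> bool" where
  "BGW_recursion N hbar M f \<longleftrightarrow> (\<forall>\<gamma>.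
     (\<Sum>i<M. of_nat (lookp \<gamma> i + 1) * f (\<gamma> + exp1 i))
     = hbar / 4 * ((\<Sum>i<M. of_nat (lookp \<gamma> i * (lookp \<gamma> i + 1))) - (\<Sum>j<M. of_nat (j * (j + 1)))
          + of_nat M * (1/4 - N^2)) * f \<gamma>)"

text \<open>The last clause compares numerators rather than quotients, hence \<open>unshift\<close>:
  it is the restriction to \<open>x_M = 0\<close>.\<close>

definition stable_family :: "complex \<Rightarrow> complex \<Rightarrow> (nat \<Rightarrow> mser) \<Rightarrow> bool" where
  "stable_family N hbar f \<longleftrightarrow> f 0 0 = 1 \<and> (\<forall>M. BGW_recursion N hbar M (f M))
     \<and> (\<forall>M \<gamma>. \<not> Poly_Mapping.keys \<gamma> \<subseteq> {..<M} \<longrightarrow> f M \<gamma> = 0)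
     \<and> (\<forall>M \<gamma>. Poly_Mapping.keys \<gamma> \<subseteq> {..<M} \<longrightarrow> f (Suc M) \<gamma> = unshift M (f M) \<gamma>)"

text \<open>Stability makes the difference of two families vanish at \<open>x\<^sub>M = 0\<close> once they agree for \<open>M\<close>
  variables; the recursion then propagates zero along powers of \<open>x\<^sub>M\<close>.\<close>

lemma stable_family_unique:
  assumes f: "stable_family N hbar f" and g: "stable_family N hbar g"
  shows "f M = g M"
proof (induction M)
  case 0
  show ?case
  proof
    fix \<gamma> show "f 0 \<gamma> = g 0 \<gamma>"
      using f g by (cases "\<gamma> = 0") (auto simp: stable_family_def)
  qed
next
  case (Suc M)
  define r where "r \<gamma> = f (Suc M) \<gamma> - g (Suc M) \<gamma>" for \<gamma>
  have out: "r \<gamma> = 0" if "\<not> Poly_Mapping.keys \<gamma> \<subseteq> {..<Suc M}" for \<gamma>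
    using f g that by (simp add: stable_family_def r_def)
  have base: "r \<gamma> = 0" if "lookp \<gamma> M = 0" for \<gamma>
  proof (cases "Poly_Mapping.keys \<gamma> \<subseteq> {..<Suc M}")
    case True
    have "Poly_Mapping.keys \<gamma> \<subseteq> {..<M}"
    proof
      fix i assume i: "i \<in> Poly_Mapping.keys \<gamma>"
      then have "i < Suc M" using True by blast
      moreover have "i \<noteq> M" using i that by (auto simp: in_keys_iff)
      ultimately show "i \<in> {..<M}" by simp
    qed
    then show ?thesis using f g Suc by (simp add: stable_family_def r_def)
  qed (rule out)
  have rec: "\<exists>c. (\<Sum>i<Suc M. of_nat (lookp \<gamma> i + 1) * r (\<gamma> + exp1 i)) = c * r \<gamma>" for \<gamma>
  proof -
    obtain c where "(\<Sum>i<Suc M. of_nat (lookp \<gamma> i + 1) * f (Suc M) (\<gamma> + exp1 i)) = c * f (Suc M) \<gamma>"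
      "(\<Sum>i<Suc M. of_nat (lookp \<gamma> i + 1) * g (Suc M) (\<gamma> + exp1 i)) = c * g (Suc M) \<gamma>"
      using f g unfolding stable_family_def BGW_recursion_def by blast
    then show ?thesis unfolding r_def right_diff_distrib sum_subtractf by metis
  qed
  have "r \<gamma> = 0" for \<gamma>
  \<comment> \<open>In the recursion at \<open>\<gamma> - exp1 M\<close>, the right side has smaller
    total degree, and the remaining terms on the left have the same degree but a smaller exponent of
    \<open>x_M\<close>.\<close>
  proof (induction "(tot_deg \<gamma>, lookp \<gamma> M)" arbitrary: \<gamma> rule: wf_induct_rule[OF wf_lex_prod[OF wf_less_than wf_less_than]])
    case 1
    show ?case
    proof (cases "lookp \<gamma> M = 0")
      case False
      define \<delta> where "\<delta> = \<gamma> - exp1 M"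
      have \<gamma>: "\<gamma> = \<delta> + exp1 M" unfolding \<delta>_def using False by (intro exp1_diff_add[symmetric]) simp
      obtain c where c: "(\<Sum>i<Suc M. of_nat (lookp \<delta> i + 1) * r (\<delta> + exp1 i)) = c * r \<delta>" using rec by blast
      have "r \<delta> = 0" by (rule 1) (simp add: \<gamma> tot_deg_add)
      moreover have "r (\<delta> + exp1 i) = 0" if "i < M" for i
        by (rule 1) (use that in \<open>simp add: \<gamma> tot_deg_add lookup_add lookup_single\<close>)
      ultimately have "of_nat (lookp \<delta> M + 1) * r \<gamma> = 0" using c by (simp add: \<gamma>)
      moreover have "of_nat (lookp \<delta> M + 1) \<noteq> (0::complex)" by (metis Suc_eq_plus1 of_nat_neq_0)
      ultimately show ?thesis by simp
    qed (rule base)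
  qed
  then show ?case by (auto simp: r_def)
qed

subsection \<open>The determinant\<close>

text \<open>The coefficient of \<open>x^n\<close> in \<open>x^{M-1} Phi_{j+1}(1/x)\<close>: the
  entries of column \<open>j\<close> are this one series in different variables.\<close>

definition psi :: "complex \<Rightarrow> complex \<Rightarrow> nat \<Rightarrow> nat \<Rightarrow> nat \<Rightarrow> complex" where
  "psi N hbar M j n = (if M - 1 - j \<le> n then phi_coef N hbar (int j + 1) (n - (M - 1 - j)) else 0)"

lemma ms_mult_single_variable:
  assumes f: "\<And>\<beta>. f \<beta> \<noteq> 0 \<Longrightarrow> \<exists>n. \<beta> = Poly_Mapping.single i n"
    and g: "\<And>\<beta>. g \<beta> \<noteq> 0 \<Longrightarrow> lookp \<beta> i = 0"
  shows "ms_mult f g \<gamma> = f (Poly_Mapping.single i (lookp \<gamma> i)) * g (\<gamma> - Poly_Mapping.single i (lookp \<gamma> i))"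
proof -
  let ?p = "(Poly_Mapping.single i (lookp \<gamma> i), \<gamma> - Poly_Mapping.single i (lookp \<gamma> i))"
  have "ms_mult f g \<gamma> = (\<Sum>p\<in>{?p}. f (fst p) * g (snd p))"
    unfolding ms_mult_def
  proof (rule sum.mono_neutral_right[OF finite_splits])
    show "{?p} \<subseteq> {p. fst p + snd p = \<gamma>}"
      by (auto intro!: poly_mapping_eqI simp: lookup_add lookup_minus lookup_single when_def)
    have "p = ?p" if p: "fst p + snd p = \<gamma>" "f (fst p) * g (snd p) \<noteq> 0" for p
    proof -
      obtain n where n: "fst p = Poly_Mapping.single i n" using f p(2) by auto
      have "lookp (snd p) i = 0" using g p(2) by auto
      then have "n = lookp \<gamma> i" by (simp add: p(1)[symmetric] n lookup_add)
      moreover from this have "snd p = \<gamma> - Poly_Mapping.single i (lookp \<gamma> i)"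
        using p(1) n by (metis add_diff_cancel_left')
      ultimately show ?thesis using n by (simp add: prod_eq_iff)
    qed
    then show "\<forall>p\<in>{p. fst p + snd p = \<gamma>} - {?p}. f (fst p) * g (snd p) = 0" by blast
  qed
  then show ?thesis by simp
qed

text \<open>Distinct rows of the matrix use distinct variables, so a monomial splits among the
  factors in only one way.\<close>

lemma ms_prodl_single_variables:
  assumes "distinct xs" and f: "\<And>i \<beta>. f i \<beta> \<noteq> 0 \<Longrightarrow> \<exists>n. \<beta> = Poly_Mapping.single i n"
  shows "ms_prodl (map f xs) \<gamma> = (if Poly_Mapping.keys \<gamma> \<subseteq> set xs
     then \<Prod>i\<in>set xs. f i (Poly_Mapping.single i (lookp \<gamma> i)) else 0)"
  using assms(1)
proof (induction xs arbitrary: \<gamma>)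
  case Nil
  then show ?case by (simp add: ms_prodl_def ms_one_def)
next
  case (Cons i xs)
  let ?g = "ms_prodl (map f xs)" and ?\<gamma> = "\<gamma> - Poly_Mapping.single i (lookp \<gamma> i)"
  have l: "lookp ?\<gamma> j = (if j = i then 0 else lookp \<gamma> j)" for j
    by (simp add: lookup_minus lookup_single when_def)
  have "ms_prodl (map f (i # xs)) \<gamma> = ms_mult (f i) ?g \<gamma>" by (simp add: ms_prodl_def)
  also have "\<dots> = f i (Poly_Mapping.single i (lookp \<gamma> i)) * ?g ?\<gamma>"
  proof (rule ms_mult_single_variable[OF f])
    fix \<beta> assume "?g \<beta> \<noteq> 0"
    then have "Poly_Mapping.keys \<beta> \<subseteq> set xs" using Cons by (auto split: if_splits)
    then show "lookp \<beta> i = 0" using Cons.prems by (auto simp: in_keys_iff)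
  qed
  also have "?g ?\<gamma> = (if Poly_Mapping.keys \<gamma> \<subseteq> set (i # xs)
     then \<Prod>j\<in>set xs. f j (Poly_Mapping.single j (lookp \<gamma> j)) else 0)"
  proof -
    have "Poly_Mapping.keys ?\<gamma> = Poly_Mapping.keys \<gamma> - {i}" by (auto simp: in_keys_iff l split: if_splits)
    then have k: "Poly_Mapping.keys ?\<gamma> \<subseteq> set xs \<longleftrightarrow> Poly_Mapping.keys \<gamma> \<subseteq> set (i # xs)" by auto
    have p: "(\<Prod>j\<in>set xs. f j (Poly_Mapping.single j (lookp ?\<gamma> j))) = (\<Prod>j\<in>set xs. f j (Poly_Mapping.single j (lookp \<gamma> j)))"
      by (rule prod.cong) (use Cons.prems in \<open>auto simp: l\<close>)
    show ?thesis using Cons by (simp only: k p distinct.simps)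
  qed
  finally show ?case using Cons.prems by simp
qed

lemma bgw_det_eq:
  "bgw_det N hbar M \<gamma> = (if Poly_Mapping.keys \<gamma> \<subseteq> {..<M} then
     \<Sum>\<sigma> | \<sigma> permutes {..<M}. of_int (sign \<sigma>) * (\<Prod>i<M. psi N hbar M (\<sigma> i) (lookp \<gamma> i)) else 0)"
proof -
  have "ms_prodl (map (\<lambda>i. bgw_entry N hbar M i (\<sigma> i)) [0..<M]) \<gamma>
     = (if Poly_Mapping.keys \<gamma> \<subseteq> {..<M} then \<Prod>i<M. psi N hbar M (\<sigma> i) (lookp \<gamma> i) else 0)" for \<sigma>
  proof (subst ms_prodl_single_variables)
    show "\<exists>n. \<beta> = Poly_Mapping.single i n" if "bgw_entry N hbar M i (\<sigma> i) \<beta> \<noteq> 0" for i \<beta>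
      using that by (auto simp: bgw_entry_def split: if_splits)
    have "bgw_entry N hbar M i j (Poly_Mapping.single i n) = psi N hbar M j n" for i j n
      unfolding bgw_entry_def psi_def by auto
    then show "(if Poly_Mapping.keys \<gamma> \<subseteq> set [0..<M] then \<Prod>i\<in>set [0..<M].
          bgw_entry N hbar M i (\<sigma> i) (Poly_Mapping.single i (lookp \<gamma> i)) else 0)
       = (if Poly_Mapping.keys \<gamma> \<subseteq> {..<M} then \<Prod>i<M. psi N hbar M (\<sigma> i) (lookp \<gamma> i) else 0)"
      by (simp add: atLeast0LessThan)
  qed simp
  then show ?thesis by (simp add: bgw_det_def atLeast0LessThan)
qed

lemma a_coef_Suc: "a_coef (Suc k) (\<nu> + 1) = a_coef k (\<nu> + 1) * (4 * \<nu>^2 - (2 * of_nat k + 1)^2)"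
  by (simp add: a_coef_def prod.nat_ivl_Suc' mult.commute add.commute)

text \<open>Factoring the differences of squares writes \<open>a_coef k (\<nu> + 1)\<close> as a
  product of terms \<open>2\<nu> - 2i + 1\<close> and \<open>2\<nu> + 2i - 1\<close>. Raising
  \<open>\<nu>\<close> by one shifts both progressions by 2, and only two new factors
  remain.\<close>

lemma a_coef_raise:
  "a_coef (Suc k) (\<nu> + 2) = (2*\<nu> + 2 * of_nat k + 1) * (2*\<nu> + 2 * of_nat k + 3) * a_coef k (\<nu> + 1)"
proof (induction k)
  case 0
  show ?case by (simp add: a_coef_def power2_eq_square algebra_simps)
next
  case (Suc k)
  have "a_coef (Suc (Suc k)) (\<nu> + 2) = a_coef (Suc k) (\<nu> + 2) * (4 * (\<nu>+1)^2 - (2 * of_nat (Suc k) + 1)^2)"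
    using a_coef_Suc[of "Suc k" "\<nu> + 1"] by (simp add: add.assoc)
  then show ?case
    unfolding Suc a_coef_Suc by (simp add: power2_eq_square algebra_simps)
qed

text \<open>The first relation stays in one column, the second passes to the next; both express the
  new coefficient through the same \<open>c j k\<close>, which closes the recursion for
  \<open>psi\<close>.\<close>

lemma phi_coef_Suc:
  fixes N hbar :: complex
  defines "c \<equiv> \<lambda>j k. phi_coef N hbar (int j + 1) k"
  shows "16 * of_nat (Suc k) * c j (Suc k) = - hbar * (4 * (of_nat j - N)^2 - (2 * of_nat k + 1)^2) * c j k"
    and "16 * of_nat (Suc k) * c (Suc j) (Suc k)
       = - hbar * (2 * (of_nat j - N) + 2 * of_nat k + 1) * (2 * (of_nat j - N) + 2 * of_nat k + 3) * c j k"
proof -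
  have c: "c i l = (-hbar)^l * a_coef l (of_nat i - N + 1) / (16^l * of_nat (fact l))" for i l
    by (simp add: c_def phi_coef_def a_coef_def algebra_simps)
  have c': "16 * of_nat (Suc k) * c i (Suc k) = - hbar * ((-hbar)^k * a_coef (Suc k) (of_nat i - N + 1) / (16^k * of_nat (fact k)))" for i
    using of_nat_neq_0[of k, where 'a=complex]
    unfolding c power_Suc fact_Suc of_nat_mult by (simp add: divide_simps del: of_nat_Suc)
  show "16 * of_nat (Suc k) * c j (Suc k) = - hbar * (4 * (of_nat j - N)^2 - (2 * of_nat k + 1)^2) * c j k"
    unfolding c' unfolding a_coef_Suc c by simp
  have e: "of_nat (Suc j) - N + 1 = (of_nat j - N) + 2" by simp
  show "16 * of_nat (Suc k) * c (Suc j) (Suc k)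
       = - hbar * (2 * (of_nat j - N) + 2 * of_nat k + 1) * (2 * (of_nat j - N) + 2 * of_nat k + 3) * c j k"
    unfolding c' unfolding e a_coef_raise c by simp
qed


text \<open>The operator \<open>hbar (x\<^sup>2\<partial>\<^sup>2 + 2x\<partial> + 1/4 - N\<^sup>2) / 4 - \<partial>\<close> maps \<open>psi\<^sub>j\<close> into the span
  of \<open>psi\<^sub>j\<close> and \<open>psi\<^sub>j\<^sub>+\<^sub>1\<close>.\<close>

lemma psi_recursion:
  assumes "j < M"
  defines "s \<equiv> M - 1 - j"
  shows "of_nat (n + 1) * psi N hbar M j (n + 1)
    = hbar / 4 * (of_nat (n * (n + 1)) + (1/4 - N^2) - ((of_nat s - of_nat j)^2 + 2 * N * (of_nat s - of_nat j))) * psi N hbar M j n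
      + of_nat s * psi N hbar M (j + 1) n"
proof -
  consider "n + 1 < s" | "n + 1 = s" | "s \<le> n" by linarith
  then show ?thesis
  proof cases
    case 1
    then show ?thesis using assms(1) by (auto simp: psi_def s_def)
  next
    case 2
    \<comment> \<open>Here only the derivative of the leading power \<open>x^s\<close> occurs; it is
      matched by the leading power \<open>x^{s-1}\<close> of the next column.\<close>
    then have "M - 1 - (j + 1) = n" "\<not> s \<le> n" by (auto simp: s_def)
    then show ?thesis using 2 unfolding psi_def s_def[symmetric] by (simp add: phi_coef_def)
  next
    case 3
    then obtain k where n: "n = s + k" using le_Suc_ex by blast
    define c where "c i l = phi_coef N hbar (int i + 1) l" for i l
    have p: "psi N hbar M j (n + 1) = c j (Suc k)" "psi N hbar M j n = c j k"
      unfolding psi_def s_def[symmetric] c_def n by simp_all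
    have p': "of_nat s * psi N hbar M (j + 1) n = of_nat s * c (Suc j) (Suc k)"
    \<comment> \<open>For \<open>s = 0\<close> column \<open>j\<close> is the last one and column
      \<open>j + 1\<close> is meaningless, but its coefficient is zero.\<close>
    proof (cases "s = 0")
      case False
      then have "M - 1 - (j + 1) = s - 1" by (simp add: s_def)
      moreover have "n - (s - 1) = Suc k" "s - 1 \<le> n" using False n by auto
      ultimately show ?thesis by (simp add: psi_def c_def add.commute)
    qed simp
    \<comment> \<open>The factor \<open>F\<close> clears the denominators of both relations in
      \<open>phi_coef_Suc\<close>, reducing the claim to a polynomial identity times
      \<open>c j k\<close>.\<close>
    define K S J F :: complex where "K = of_nat k" and "S = of_nat s" and "J = of_nat j" and "F = 16 * of_nat (Suc k)"
    have F: "F \<noteq> 0" unfolding F_def using of_nat_neq_0[of k, where 'a=complex] by (simp del: of_nat_Suc)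
    have c1: "F * c j (Suc k) = - hbar * (4 * (J - N)^2 - (2 * K + 1)^2) * c j k"
      and c2: "F * c (Suc j) (Suc k) = - hbar * (2 * (J - N) + 2 * K + 1) * (2 * (J - N) + 2 * K + 3) * c j k"
      unfolding F_def c_def J_def K_def by (rule phi_coef_Suc)+
    have "F * (of_nat (n + 1) * c j (Suc k)) = (S + K + 1) * (F * c j (Suc k))"
      by (simp add: n S_def K_def algebra_simps)
    also have "\<dots> = F * (hbar / 4 * (of_nat (n * (n + 1)) + (1/4 - N^2) - ((S - J)^2 + 2 * N * (S - J))) * c j k)
        + S * (F * c (Suc j) (Suc k))"
      unfolding c1 c2 by (simp add: F_def n S_def[symmetric] K_def[symmetric] power2_eq_square field_simps)
    also have "\<dots> = F * (hbar / 4 * (of_nat (n * (n + 1)) + (1/4 - N^2) - ((S - J)^2 + 2 * N * (S - J))) * c j k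
        + S * c (Suc j) (Suc k))" by (simp add: algebra_simps)
    finally show ?thesis unfolding p p' S_def J_def using F mult_left_cancel by blast
  qed
qed

text \<open>A determinant with two equal columns vanishes: composing with the transposition flips
  the sign and preserves \<open>H\<close>.\<close>

lemma sum_sign_alternating:
  fixes H :: "(nat \<Rightarrow> nat) \<Rightarrow> complex"
  assumes "a \<in> S" "b \<in> S" "a \<noteq> b" and H: "\<And>\<sigma>. H (transpose a b \<circ> \<sigma>) = H \<sigma>"
    and "finite S"
  shows "(\<Sum>\<sigma> | \<sigma> permutes S. of_int (sign \<sigma>) * H \<sigma>) = 0"
proof -
  let ?t = "transpose a b"
  have t: "?t permutes S" using assms by (intro permutes_swap_id) auto
  have "(\<Sum>\<sigma> | \<sigma> permutes S. of_int (sign \<sigma>) * H \<sigma>)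
      = (\<Sum>\<sigma> | \<sigma> permutes S. of_int (sign (?t \<circ> \<sigma>)) * H (?t \<circ> \<sigma>))"
    by (rule setum_permutations_compose_left[OF t])
  also have "\<dots> = (\<Sum>\<sigma> | \<sigma> permutes S. - (of_int (sign \<sigma>) * H \<sigma>))"
  proof (rule sum.cong[OF refl])
    fix \<sigma> assume "\<sigma> \<in> {\<sigma>. \<sigma> permutes S}"
    then have "sign (?t \<circ> \<sigma>) = - sign \<sigma>"
      using assms(3,5) permutation_permutes
      by (subst sign_compose) (auto simp: permutation_swap_id sign_swap_id)
    then show "of_int (sign (?t \<circ> \<sigma>)) * H (?t \<circ> \<sigma>) = - (of_int (sign \<sigma>) * H \<sigma>)"
      by (simp add: H)
  qed
  finally show ?thesis by (simp add: sum_negf)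
qed

text \<open>Matches the trace of the one-variable operator on the columns with the Vandermonde
  eigenvalue. The term linear in \<open>N\<close> vanishes under
  \<open>j \<mapsto> M - 1 - j\<close>, and both remaining sums equal
  \<open>(M-1) M (M+1) / 3\<close>.\<close>

lemma sum_eigenvalues:
  "(\<Sum>j<M. (of_nat (M - 1 - j) - of_nat j)^2 + 2 * N * (of_nat (M - 1 - j) - of_nat j))
    = (\<Sum>j<M. of_nat (j * (j + 1)) :: complex)"
proof -
  let ?m = "of_nat M :: complex"
  have r: "(\<Sum>j<M. f (M - 1 - j)) = (\<Sum>j<M. f j)" for f :: "nat \<Rightarrow> complex"
    using sum.nat_diff_reindex[of f M] by simp
  have 1: "(\<Sum>j<M. of_nat (M - 1 - j) - of_nat j :: complex) = 0"
    unfolding sum_subtractf using r[of of_nat] by simp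
  \<comment> \<open>The constant \<open>c\<close> stays free so that the induction on
    \<open>M\<close> does not change the summand; it is used with \<open>c = M - 1\<close>.\<close>
  have a: "3 * (\<Sum>j<M. (c - 2 * of_nat j)^2) = 3 * ?m * c^2 - 6 * c * ?m * (?m - 1) + 2 * ?m * (?m - 1) * (2 * ?m - 1)" for c :: complex
    by (induction M) (simp_all add: algebra_simps power2_eq_square)
  have b: "3 * (\<Sum>j<M. of_nat (j * (j + 1)) :: complex) = (?m - 1) * ?m * (?m + 1)"
    by (induction M) (simp_all add: algebra_simps)
  have "(\<Sum>j<M. (of_nat (M - 1 - j) - of_nat j :: complex)^2) = (\<Sum>j<M. ((?m - 1) - 2 * of_nat j)^2)"
    by (rule sum.cong) (auto simp: of_nat_diff algebra_simps)
  moreover have "3 * (\<Sum>j<M. ((?m - 1) - 2 * of_nat j)^2) = 3 * (\<Sum>j<M. of_nat (j * (j + 1)) :: complex)"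
    unfolding a b by (simp add: algebra_simps power2_eq_square)
  ultimately have 2: "(\<Sum>j<M. (of_nat (M - 1 - j) - of_nat j :: complex)^2) = (\<Sum>j<M. of_nat (j * (j + 1)))"
    by simp
  show ?thesis unfolding sum.distrib 2 sum_distrib_left[symmetric] 1 by simp
qed

text \<open>By \<open>psi_recursion\<close> each row derivative yields a diagonal term and a term
  with column \<open>j\<close> replaced by column \<open>j + 1\<close>. The diagonal terms add up to
  the trace, the same for every permutation. The replaced determinants have two equal
  columns.\<close>

lemma bgw_det_recursion: "BGW_recursion N hbar M (bgw_det N hbar M)"
  unfolding BGW_recursion_def
proof
  fix \<gamma>
  let ?P = "{\<sigma>. \<sigma> permutes {..<M}}"
  define E :: "nat \<Rightarrow> complex" where
    "E j = (of_nat (M - 1 - j) - of_nat j)^2 + 2 * N * (of_nat (M - 1 - j) - of_nat j)" for j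
  let ?rhs = "hbar / 4 * ((\<Sum>i<M. of_nat (lookp \<gamma> i * (lookp \<gamma> i + 1))) - (\<Sum>j<M. of_nat (j * (j + 1)))
          + of_nat M * (1/4 - N^2)) * bgw_det N hbar M \<gamma>"
  define t where "t i = of_nat (lookp \<gamma> i * (lookp \<gamma> i + 1)) + (1/4 - N^2)" for i
  show "(\<Sum>i<M. of_nat (lookp \<gamma> i + 1) * bgw_det N hbar M (\<gamma> + exp1 i)) = ?rhs"
  proof (cases "Poly_Mapping.keys \<gamma> \<subseteq> {..<M}")
    case False
    then have "bgw_det N hbar M \<gamma> = 0" "bgw_det N hbar M (\<gamma> + exp1 i) = 0" for i
      by (auto simp: bgw_det_eq keys_add_exp1)
    then show ?thesis by simp
  next
    case True
    define p where "p j i = psi N hbar M j (lookp \<gamma> i)" for j i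
    define A where "A \<sigma> = (\<Prod>k<M. p (\<sigma> k) k)" for \<sigma> :: "nat \<Rightarrow> nat"
    define raise where "raise j x = (if x = j then j + 1 else x)" for j x :: nat
    define B where "B j \<sigma> = (\<Prod>k<M. p (raise j (\<sigma> k)) k)" for j and \<sigma> :: "nat \<Rightarrow> nat"
    have step: "of_nat (lookp \<gamma> i + 1) * (\<Prod>k<M. psi N hbar M (\<sigma> k) (lookp (\<gamma> + exp1 i) k))
       = hbar / 4 * (t i - E (\<sigma> i)) * A \<sigma> + of_nat (M - 1 - \<sigma> i) * B (\<sigma> i) \<sigma>"
      if \<sigma>: "\<sigma> permutes {..<M}" and i: "i < M" for \<sigma> i
    proof -
      have \<sigma>i: "\<sigma> i < M" using permutes_in_image[OF \<sigma>] i by auto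
      define R where "R = (\<Prod>k\<in>{..<M} - {i}. p (\<sigma> k) k)"
      have "(\<Prod>k<M. psi N hbar M (\<sigma> k) (lookp (\<gamma> + exp1 i) k)) = psi N hbar M (\<sigma> i) (lookp \<gamma> i + 1) * R"
        unfolding R_def p_def using i
        by (subst prod.remove[of _ i]) (auto simp: lookup_add lookup_single when_def intro!: prod.cong)
      moreover have "A \<sigma> = p (\<sigma> i) i * R"
        unfolding R_def A_def using i by (subst prod.remove[of _ i]) auto
      moreover have "B (\<sigma> i) \<sigma> = p (\<sigma> i + 1) i * R"
      proof -
        have "\<sigma> k \<noteq> \<sigma> i" if "k \<noteq> i" for k using permutes_inj[OF \<sigma>] that by (auto dest: injD)
        then show ?thesis
          unfolding R_def B_def using i by (subst prod.remove[of _ i]) (auto simp: raise_def intro!: prod.cong)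
      qed
      moreover have "of_nat (lookp \<gamma> i + 1) * psi N hbar M (\<sigma> i) (lookp \<gamma> i + 1)
         = hbar / 4 * (t i - E (\<sigma> i)) * p (\<sigma> i) i + of_nat (M - 1 - \<sigma> i) * p (\<sigma> i + 1) i"
        unfolding psi_recursion[OF \<sigma>i] by (simp add: t_def p_def E_def)
      ultimately show ?thesis by (simp only: mult.assoc[symmetric]) (simp add: algebra_simps)
    qed
    have perm: "(\<Sum>i<M. g (\<sigma> i)) = (\<Sum>j<M. g j)" if "\<sigma> permutes {..<M}" for \<sigma> and g :: "nat \<Rightarrow> complex"
      using sum.permute[OF that, of g] by (simp add: o_def)
    have "(\<Sum>i<M. of_nat (lookp \<gamma> i + 1) * bgw_det N hbar M (\<gamma> + exp1 i))
       = (\<Sum>i<M. \<Sum>\<sigma>\<in>?P. of_int (sign \<sigma>) * (of_nat (lookp \<gamma> i + 1) * (\<Prod>k<M. psi N hbar M (\<sigma> k) (lookp (\<gamma> + exp1 i) k))))"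
      using True by (intro sum.cong refl) (simp add: bgw_det_eq keys_add_exp1 sum_distrib_left mult.left_commute)
    also have "\<dots> = (\<Sum>\<sigma>\<in>?P. of_int (sign \<sigma>) * (\<Sum>i<M. hbar / 4 * (t i - E (\<sigma> i)) * A \<sigma> + of_nat (M - 1 - \<sigma> i) * B (\<sigma> i) \<sigma>))"
      unfolding sum_distrib_left by (subst sum.swap) (intro sum.cong refl arg_cong2[where f="(*)"] step; simp)
    also have "\<dots> = (\<Sum>\<sigma>\<in>?P. of_int (sign \<sigma>) * (hbar / 4 * ((\<Sum>i<M. t i) - (\<Sum>j<M. E j)) * A \<sigma> + (\<Sum>j<M. of_nat (M - 1 - j) * B j \<sigma>)))"
    proof (rule sum.cong[OF refl])
      fix \<sigma> assume "\<sigma> \<in> ?P"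
      then have \<sigma>: "\<sigma> permutes {..<M}" by simp
      have 1: "(\<Sum>i<M. hbar / 4 * (t i - E (\<sigma> i)) * A \<sigma>) = hbar / 4 * ((\<Sum>i<M. t i) - (\<Sum>i<M. E (\<sigma> i))) * A \<sigma>"
        by (simp only: sum_distrib_left[symmetric] sum_distrib_right[symmetric] sum_subtractf)
      then show "of_int (sign \<sigma>) * (\<Sum>i<M. hbar / 4 * (t i - E (\<sigma> i)) * A \<sigma> + of_nat (M - 1 - \<sigma> i) * B (\<sigma> i) \<sigma>)
        = of_int (sign \<sigma>) * (hbar / 4 * ((\<Sum>i<M. t i) - (\<Sum>j<M. E j)) * A \<sigma> + (\<Sum>j<M. of_nat (M - 1 - j) * B j \<sigma>))"
        using perm[OF \<sigma>, of E] perm[OF \<sigma>, of "\<lambda>j. of_nat (M - 1 - j) * B j \<sigma>"]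
        by (simp only: sum.distrib 1)
    qed
    also have "\<dots> = hbar / 4 * ((\<Sum>i<M. t i) - (\<Sum>j<M. E j)) * (\<Sum>\<sigma>\<in>?P. of_int (sign \<sigma>) * A \<sigma>)
        + (\<Sum>j<M. of_nat (M - 1 - j) * (\<Sum>\<sigma>\<in>?P. of_int (sign \<sigma>) * B j \<sigma>))"
    proof -
      have "(\<Sum>j<M. of_nat (M - 1 - j) * (\<Sum>\<sigma>\<in>?P. of_int (sign \<sigma>) * B j \<sigma>))
         = (\<Sum>\<sigma>\<in>?P. of_int (sign \<sigma>) * (\<Sum>j<M. of_nat (M - 1 - j) * B j \<sigma>))"
        unfolding sum_distrib_left by (subst sum.swap) (simp only: mult.left_commute)
      then show ?thesis
        unfolding distrib_left sum.distrib sum_distrib_left[of _ _ ?P] by (simp only: mult.left_commute)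
    qed
    also have "(\<Sum>j<M. of_nat (M - 1 - j) * (\<Sum>\<sigma>\<in>?P. of_int (sign \<sigma>) * B j \<sigma>)) = 0"
    proof (rule sum.neutral, safe)
      fix j assume "j < M"
      show "of_nat (M - 1 - j) * (\<Sum>\<sigma>\<in>?P. of_int (sign \<sigma>) * B j \<sigma>) = 0"
      \<comment> \<open>In the last column there is no next one to coincide with, but there the
        factor \<open>M - 1 - j\<close> is zero.\<close>
      proof (cases "j + 1 < M")
        case True
        have "raise j (transpose j (j+1) x) = raise j x" for x
          by (auto simp: raise_def transpose_def)
        then have "(\<Sum>\<sigma>\<in>?P. of_int (sign \<sigma>) * B j \<sigma>) = 0"
          using True by (intro sum_sign_alternating[of j _ "j+1"]) (auto simp: B_def)
        then show ?thesis by simp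
      qed (use \<open>j < M\<close> in simp)
    qed
    also have "(\<Sum>\<sigma>\<in>?P. of_int (sign \<sigma>) * A \<sigma>) = bgw_det N hbar M \<gamma>"
      using True by (simp add: bgw_det_eq A_def p_def)
    also have "(\<Sum>i<M. t i) = (\<Sum>i<M. of_nat (lookp \<gamma> i * (lookp \<gamma> i + 1))) + of_nat M * (1/4 - N^2)"
      by (simp add: t_def sum.distrib)
    also have "(\<Sum>j<M. E j) = (\<Sum>j<M. of_nat (j * (j + 1)))"
      unfolding E_def by (rule sum_eigenvalues)
    finally show ?thesis by (simp add: algebra_simps)
  qed
qed

text \<open>Adding a variable multiplies each old column by \<open>x\<close>.\<close>

lemma psi_stable:
  assumes "j < M"
  shows "psi N hbar (Suc M) j n = (if n = 0 then 0 else psi N hbar M j (n - 1))"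
  using assms by (cases n) (auto simp: psi_def Suc_diff_le diff_le_mono Suc_diff_Suc)

text \<open>At \<open>x_M = 0\<close> only the new column has a nonzero entry in row
  \<open>M\<close>, namely 1, so only permutations fixing \<open>M\<close> survive. The old columns
  each gain a factor \<open>x\<close>.\<close>

lemma bgw_det_stable:
  assumes "Poly_Mapping.keys \<gamma> \<subseteq> {..<M}"
  shows "bgw_det N hbar (Suc M) \<gamma> = unshift M (bgw_det N hbar M) \<gamma>"
proof -
  let ?p = "\<lambda>\<sigma>. \<Prod>i<Suc M. psi N hbar (Suc M) (\<sigma> i) (lookp \<gamma> i)"
  have \<gamma>M: "lookp \<gamma> M = 0" using assms by (auto simp: in_keys_iff)
  have 0: "?p \<sigma> = 0" if "\<sigma> permutes {..<Suc M}" "\<not> \<sigma> permutes {..<M}" for \<sigma>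
  proof -
    have "\<sigma> M \<noteq> M"
    proof
      assume "\<sigma> M = M"
      then have "\<sigma> permutes {..<M}"
        using that(1) by (intro permutes_superset[OF that(1)]) (auto simp: less_Suc_eq)
      then show False using that(2) by simp
    qed
    moreover have "\<sigma> M < Suc M" using permutes_in_image[OF that(1)] by auto
    ultimately have "psi N hbar (Suc M) (\<sigma> M) (lookp \<gamma> M) = 0" by (simp add: \<gamma>M psi_def)
    then show ?thesis by simp
  qed
  have 1: "?p \<sigma> = (if \<forall>i<M. 1 \<le> lookp \<gamma> i then \<Prod>i<M. psi N hbar M (\<sigma> i) (lookp (\<gamma> - ones M) i) else 0)"
    if \<sigma>: "\<sigma> permutes {..<M}" for \<sigma>
  proof -
    have "\<sigma> M = M" using permutes_not_in[OF \<sigma>] by simp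
    then have "psi N hbar (Suc M) (\<sigma> M) (lookp \<gamma> M) = 1" by (simp add: \<gamma>M psi_def phi_coef_def)
    then have "?p \<sigma> = (\<Prod>i<M. if lookp \<gamma> i = 0 then 0 else psi N hbar M (\<sigma> i) (lookp \<gamma> i - 1))"
      using permutes_in_image[OF \<sigma>] by (simp add: psi_stable)
    also have "\<dots> = (if \<forall>i<M. 1 \<le> lookp \<gamma> i then \<Prod>i<M. psi N hbar M (\<sigma> i) (lookp (\<gamma> - ones M) i) else 0)"
    proof (cases "\<forall>i<M. 1 \<le> lookp \<gamma> i")
      case True
      then show ?thesis by (auto simp: lookup_minus lookup_ones intro!: prod.cong)
    next
      case False
      then have "\<exists>i\<in>{..<M}. (if lookp \<gamma> i = 0 then 0 else psi N hbar M (\<sigma> i) (lookp \<gamma> i - 1)) = 0"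
        by (metis One_nat_def lessThan_iff less_one not_le)
      then show ?thesis using False by (simp only: prod_zero finite_lessThan if_False)
    qed
    finally show ?thesis .
  qed
  have "Poly_Mapping.keys \<gamma> \<subseteq> {..<Suc M}" using assms by auto
  then have "bgw_det N hbar (Suc M) \<gamma> = (\<Sum>\<sigma> | \<sigma> permutes {..<Suc M}. of_int (sign \<sigma>) * ?p \<sigma>)"
    by (simp add: bgw_det_eq)
  also have "\<dots> = (\<Sum>\<sigma> | \<sigma> permutes {..<M}. of_int (sign \<sigma>) * ?p \<sigma>)"
    by (rule sum.mono_neutral_right)
       (use 0 in \<open>auto simp: finite_permutations intro: permutes_subset simp del: prod.lessThan_Suc\<close>)
  also have "\<dots> = unshift M (bgw_det N hbar M) \<gamma>"
  proof -
    define Q where "Q \<longleftrightarrow> (\<forall>i<M. 1 \<le> lookp \<gamma> i)"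
    have u: "unshift M f \<gamma> = (if Q then f (\<gamma> - ones M) else 0)" for f
      by (simp only: unshift_def Q_def)
    have "Poly_Mapping.keys (\<gamma> - ones M) \<subseteq> {..<M}"
      using assms by (auto simp: subset_iff in_keys_iff lookup_minus)
    then show ?thesis
      by (cases Q) (simp_all add: u bgw_det_eq 1[folded Q_def] del: prod.lessThan_Suc)
  qed
  finally show ?thesis .
qed

lemma bgw_det_stable_family: "stable_family N hbar (bgw_det N hbar)"
  unfolding stable_family_def using bgw_det_recursion bgw_det_stable
  by (auto simp: bgw_det_eq)

subsection \<open>The tau-function\<close>

lemma lookup_vander: "lookp (vander M) = vandermonde M"
proof -
  have v: "vander M = prod_list (map (\<lambda>(i,j). X i - X j) [(i,j). j \<leftarrow> [0..<M], i \<leftarrow> [0..<j]])" for M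
  proof (induction M)
    case (Suc M)
    have "(\<Prod>i<M. X i - X M) = prod_list (map (\<lambda>i. X i - X M) [0..<M])"
      by (subst prod.distinct_set_conv_list[symmetric]) (auto simp: atLeast0LessThan)
    then show ?case by (simp add: vander_Suc Suc o_def)
  qed (simp add: vander_def)
  have "lookp (X i - X j) = (\<lambda>\<beta>. ms_var i \<beta> - ms_var j \<beta>)" for i j
    by (rule ext) (auto simp: lookup_minus lookup_single ms_var_def when_def)
  then show ?thesis
    unfolding v lookup_prod_list vandermonde_def by (simp add: case_prod_unfold o_def)
qed

lemma lookup_translation:
  "lookp (translation M p) \<gamma> = (\<Sum>i<M. of_nat (lookp \<gamma> i + 1) * lookp p (\<gamma> + exp1 i))"
  by (simp add: translation_def lookup_sum lookup_dX)

lemma lookup_eq_0_kill: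
  assumes "\<And>i. M \<le> i \<Longrightarrow> kill i p = p" "\<not> Poly_Mapping.keys \<gamma> \<subseteq> {..<M}"
  shows "lookp p \<gamma> = 0"
proof -
  obtain i where "i \<in> Poly_Mapping.keys \<gamma>" "M \<le> i"
    using assms(2) by (meson lessThan_iff not_less subsetI)
  then show ?thesis using assms(1)[of i] lookup_kill[of i p \<gamma>] by (simp add: in_keys_iff)
qed

lemma lookup_kill_below: "Poly_Mapping.keys \<gamma> \<subseteq> {..<M} \<Longrightarrow> lookp (kill M p) \<gamma> = lookp p \<gamma>"
  by (metis in_keys_iff lessThan_iff less_irrefl lookup_kill subsetD)

text \<open>At \<open>hbar = 0\<close> the recursion is just translation invariance. This makes the
  uniqueness theorem available for expanding the Vandermonde product.\<close>

lemma vander_stable_family: "stable_family 0 0 (\<lambda>M. lookp (vander M))"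
  unfolding stable_family_def
proof (intro conjI allI impI)
  show "lookp (vander 0) 0 = 1" by (simp add: vander_def)
  show "BGW_recursion 0 0 M (lookp (vander M))" for M
    unfolding BGW_recursion_def lookup_translation[symmetric] translation_vander by simp
  show "lookp (vander M) \<gamma> = 0" if "\<not> Poly_Mapping.keys \<gamma> \<subseteq> {..<M}" for M \<gamma>
    using lookup_eq_0_kill[OF kill_vander that] .
  show "lookp (vander (Suc M)) \<gamma> = unshift M (lookp (vander M)) \<gamma>" if "Poly_Mapping.keys \<gamma> \<subseteq> {..<M}" for M \<gamma>
    by (metis that lookup_kill_below kill_vander_Suc lookup_ones_mult)
qed

text \<open>At \<open>hbar = 0\<close> the stable family is the classical determinant of powers, so every monomial of
  the Vandermonde product is a permutation of the staircase \<open>(M-1, \<dots>, 0)\<close>.\<close>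

lemma euler_sq_vander: "euler_sq M (vander M) = Cst (\<Sum>j<M. of_nat (j * (j + 1))) * vander M"
proof (rule poly_mapping_eqI)
  fix \<gamma>
  have eig: "(\<Sum>i<M. of_nat (lookp \<gamma> i * (lookp \<gamma> i + 1)) :: complex) = (\<Sum>j<M. of_nat (j * (j + 1)))"
    if "lookp (vander M) \<gamma> \<noteq> 0"
  proof -
    have "lookp (vander M) \<gamma> = bgw_det 0 0 M \<gamma>"
      using stable_family_unique[OF vander_stable_family bgw_det_stable_family] by metis
    then have "(\<Sum>\<sigma> | \<sigma> permutes {..<M}. of_int (sign \<sigma>) * (\<Prod>i<M. psi 0 0 M (\<sigma> i) (lookp \<gamma> i))) \<noteq> 0"
      using that by (auto simp: bgw_det_eq split: if_splits)
    then obtain \<sigma> where \<sigma>: "\<sigma> permutes {..<M}" and nz: "(\<Prod>i<M. psi 0 0 M (\<sigma> i) (lookp \<gamma> i)) \<noteq> 0"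
      by (metis (mono_tags, lifting) mem_Collect_eq mult_zero_right sum.neutral)
    \<comment> \<open>At \<open>hbar = 0\<close> each \<open>psi\<close> retains only its leading
      coefficient, which pins down every exponent.\<close>
    have \<gamma>: "lookp \<gamma> i = M - 1 - \<sigma> i" if "i < M" for i
    proof -
      have "psi 0 0 M (\<sigma> i) (lookp \<gamma> i) \<noteq> 0" using nz that by auto
      then show ?thesis by (auto simp: psi_def phi_coef_def split: if_splits)
    qed
    have "(\<Sum>i<M. of_nat (lookp \<gamma> i * (lookp \<gamma> i + 1)) :: complex)
        = (\<Sum>i<M. ((\<lambda>j. of_nat ((M - 1 - j) * (M - 1 - j + 1))) \<circ> \<sigma>) i)"
      by (rule sum.cong) (auto simp: \<gamma>)
    also have "\<dots> = (\<Sum>j<M. of_nat ((M - 1 - j) * (M - 1 - j + 1)))"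
      by (rule sum.permute[OF \<sigma>, symmetric])
    also have "\<dots> = (\<Sum>j<M. of_nat (j * (j + 1)))"
      using sum.nat_diff_reindex[of "\<lambda>j. of_nat (j * (j + 1))" M]
      by (simp only: diff_diff_left plus_1_eq_Suc)
    finally show ?thesis .
  qed
  show "lookp (euler_sq M (vander M)) \<gamma> = lookp (Cst (\<Sum>j<M. of_nat (j * (j + 1))) * vander M) \<gamma>"
    unfolding lookup_euler_sq lookup_Cst_mult using eig by (cases "lookp (vander M) \<gamma> = 0") simp_all
qed

lemma kill_miwa_trunc: "M \<le> i \<Longrightarrow> kill i (miwa_trunc M n Z) = miwa_trunc M n Z"
  by (simp add: miwa_trunc_def kill_sum kill_miwa_part)

lemma kill_miwa_trunc_Suc: "kill M (miwa_trunc (Suc M) n Z) = miwa_trunc M n Z"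
  by (simp add: miwa_trunc_def kill_sum kill_miwa_part_Suc)

lemma euler_sq_sum: "euler_sq M (sum f A) = (\<Sum>x\<in>A. euler_sq M (f x))"
  by (rule poly_mapping_eqI) (simp add: lookup_euler_sq lookup_sum sum_distrib_left)

lemma translation_sum: "translation M (sum f A) = (\<Sum>x\<in>A. translation M (f x))"
  unfolding translation_def dX_sum by (rule sum.swap)

lemma translation_add: "translation M (p + q) = translation M p + translation M q"
  by (simp add: translation_def dX_add sum.distrib)

text \<open>Summing the degreewise equations: the part of degree 0 is constant and drops out on the
  left, so truncation at \<open>Suc n\<close> there corresponds to \<open>n\<close> on the
  right.\<close>

lemma BGW_miwa_trunc:
  assumes "is_BGW_solution N hbar Z"
  shows "4 * translation M (vander M * miwa_trunc M (Suc n) Z)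
    = Cst hbar * (euler_sq M (vander M * miwa_trunc M n Z) - Cst (\<Sum>j<M. of_nat (j * (j + 1))) * (vander M * miwa_trunc M n Z)
        + of_nat M * Cst (1/4 - N^2) * (vander M * miwa_trunc M n Z))"
proof -
  let ?V = "vander M" and ?k = "Cst (\<Sum>j<M. of_nat (j * (j + 1)))" and ?c = "of_nat M * Cst (1/4 - N^2)"
  have "translation M (?V * miwa_part M 0 Z) = 0"
    by (simp add: translation_mult translation_vander miwa_part_0) (simp add: translation_def)
  then have "4 * translation M (?V * miwa_trunc M (Suc n) Z)
      = (\<Sum>d\<le>n. 4 * translation M (?V * miwa_part M (int d + 1) Z))"
    unfolding miwa_trunc_def sum.atMost_Suc_shift
    by (simp add: distrib_left translation_add translation_sum sum_distrib_left add.commute)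
  also have "\<dots> = (\<Sum>d\<le>n. Cst hbar * (euler_sq M (?V * miwa_part M (int d) Z) - ?k * (?V * miwa_part M (int d) Z)
        + ?c * (?V * miwa_part M (int d) Z)))"
    unfolding BGW_miwa_part[OF assms] euler_sq_vander by (simp only: mult.assoc)
  also have "\<dots> = Cst hbar * (euler_sq M (?V * miwa_trunc M n Z) - ?k * (?V * miwa_trunc M n Z)
        + ?c * (?V * miwa_trunc M n Z))"
    unfolding miwa_trunc_def sum_distrib_left euler_sq_sum sum_subtractf[symmetric] sum.distrib[symmetric] ..
  finally show ?thesis .
qed

definition tau_numerator :: "mser \<Rightarrow> nat \<Rightarrow> mser" where
  "tau_numerator Z M = ms_mult (miwa M Z) (vandermonde M)"

lemma tau_numerator_eq:
  "tot_deg \<gamma> \<le> n \<Longrightarrow> tau_numerator Z M \<gamma> = lookp (vander M * miwa_trunc M n Z) \<gamma>"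
  using ms_mult_miwa[of \<gamma> n M Z "vander M"] by (simp add: tau_numerator_def lookup_vander mult.commute)

lemma tau_numerator_recursion:
  assumes "is_BGW_solution N hbar Z"
  shows "BGW_recursion N hbar M (tau_numerator Z M)"
  unfolding BGW_recursion_def
proof
  fix \<gamma>
  \<comment> \<open>Truncation at \<open>n\<close> is exact at \<open>\<gamma>\<close>, and
    truncation at \<open>Suc n\<close> is exact at the monomials
    \<open>\<gamma> + exp1 i\<close>.\<close>
  define n where "n = tot_deg \<gamma>"
  let ?P = "\<lambda>n. vander M * miwa_trunc M n Z"
  let ?\<tau> = "\<Sum>i<M. of_nat (lookp \<gamma> i * (lookp \<gamma> i + 1)) :: complex" and ?\<kappa> = "\<Sum>j<M. of_nat (j * (j + 1)) :: complex"
  have f: "tau_numerator Z M \<gamma> = lookp (?P n) \<gamma>" by (rule tau_numerator_eq) (simp add: n_def)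
  have "tau_numerator Z M (\<gamma> + exp1 i) = lookp (?P (Suc n)) (\<gamma> + exp1 i)" for i
    by (rule tau_numerator_eq) (simp add: n_def tot_deg_add)
  then have "(\<Sum>i<M. of_nat (lookp \<gamma> i + 1) * tau_numerator Z M (\<gamma> + exp1 i)) = lookp (translation M (?P (Suc n))) \<gamma>"
    by (simp only: lookup_translation)
  moreover have "4 * lookp (translation M (?P (Suc n))) \<gamma> = lookp (Cst 4 * translation M (?P (Suc n))) \<gamma>"
    by (simp only: lookup_Cst_mult)
  moreover have "lookp (Cst 4 * translation M (?P (Suc n))) \<gamma>
     = hbar * (?\<tau> * lookp (?P n) \<gamma> - ?\<kappa> * lookp (?P n) \<gamma> + of_nat M * (1/4 - N^2) * lookp (?P n) \<gamma>)"
  proof -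
    have "of_nat M * Cst (1/4 - N^2) = Cst (of_nat M * (1/4 - N^2))" unfolding Cst_mult by simp
    then show ?thesis
      unfolding single_numeral BGW_miwa_trunc[OF assms]
      by (simp only: lookup_Cst_mult lookup_add lookup_minus lookup_euler_sq)
  qed
  ultimately have "4 * (\<Sum>i<M. of_nat (lookp \<gamma> i + 1) * tau_numerator Z M (\<gamma> + exp1 i))
     = hbar * (?\<tau> - ?\<kappa> + of_nat M * (1/4 - N^2)) * tau_numerator Z M \<gamma>"
    by (simp only: f left_diff_distrib distrib_right mult.assoc)
  then show "(\<Sum>i<M. of_nat (lookp \<gamma> i + 1) * tau_numerator Z M (\<gamma> + exp1 i))
     = hbar / 4 * (?\<tau> - ?\<kappa> + of_nat M * (1/4 - N^2)) * tau_numerator Z M \<gamma>"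
    by (metis (no_types, lifting) nonzero_mult_div_cancel_left times_divide_eq_left zero_neq_numeral)
qed

lemma tau_numerator_stable_family:
  assumes "is_BGW_solution N hbar Z" "Z 0 = 1"
  shows "stable_family N hbar (tau_numerator Z)"
  unfolding stable_family_def
proof (intro conjI allI impI)
  have "tau_numerator Z 0 0 = lookp (vander 0 * miwa_trunc 0 0 Z) 0"
    by (rule tau_numerator_eq) (simp add: tot_deg_def)
  then show "tau_numerator Z 0 0 = 1"
    by (simp add: vander_def miwa_trunc_def miwa_part_0 assms(2))
  show "BGW_recursion N hbar M (tau_numerator Z M)" for M
    by (rule tau_numerator_recursion[OF assms(1)])
  show "tau_numerator Z M \<gamma> = 0" if "\<not> Poly_Mapping.keys \<gamma> \<subseteq> {..<M}" for M \<gamma>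
    unfolding tau_numerator_eq[OF order_refl]
    by (rule lookup_eq_0_kill[OF _ that]) (simp add: kill_mult kill_vander kill_miwa_trunc)
  show "tau_numerator Z (Suc M) \<gamma> = unshift M (tau_numerator Z M) \<gamma>" if "Poly_Mapping.keys \<gamma> \<subseteq> {..<M}" for M \<gamma>
  proof -
    let ?n = "tot_deg \<gamma>"
    have "tau_numerator Z (Suc M) \<gamma> = lookp (kill M (vander (Suc M) * miwa_trunc (Suc M) ?n Z)) \<gamma>"
      by (simp only: lookup_kill_below[OF that] tau_numerator_eq[OF order_refl])
    also have "\<dots> = unshift M (lookp (vander M * miwa_trunc M ?n Z)) \<gamma>"
      by (simp only: kill_mult kill_vander_Suc kill_miwa_trunc_Suc mult.assoc lookup_ones_mult)
    also have "\<dots> = unshift M (tau_numerator Z M) \<gamma>"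
    \<comment> \<open>Removing \<open>ones M\<close> does not raise the degree, so the truncation
      chosen for \<open>\<gamma>\<close> remains exact.\<close>
    proof (cases "\<forall>i<M. 1 \<le> lookp \<gamma> i")
      case True
      then have "\<gamma> = ones M + (\<gamma> - ones M)"
        by (intro poly_mapping_eqI) (auto simp: lookup_add lookup_minus lookup_ones)
      then have "tot_deg (\<gamma> - ones M) \<le> ?n" by (metis le_add2 tot_deg_add)
      moreover have "unshift M f \<gamma> = f (\<gamma> - ones M)" for f
        unfolding unshift_def by (rule if_P[OF True])
      ultimately show ?thesis by (simp add: tau_numerator_eq)
    qed (simp only: unshift_def if_False)
    finally show ?thesis .
  qed
qed

lemma BGW_solution_imp_tau:
  assumes "is_BGW_solution N hbar Z" "Z 0 = 1"
  shows "is_BGW_tau N hbar Z"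
  unfolding is_BGW_tau_def tau_numerator_def[symmetric]
  using stable_family_unique[OF tau_numerator_stable_family[OF assms] bgw_det_stable_family] by simp

subsection \<open>Injectivity of the Miwa substitution\<close>

lemma homogeneous_vander: "\<exists>c. homogeneous c (vander M)"
proof -
  have X: "homogeneous 1 (X i - X j)" for i j
    by (auto simp: homogeneous_def in_keys_iff lookup_minus lookup_single when_def split: if_splits)
  have prod: "\<exists>c. homogeneous c (prod f A)" if "finite A" "\<And>x. x \<in> A \<Longrightarrow> \<exists>c. homogeneous c (f x)" for f and A :: "nat set"
    using that
  proof (induction A)
    case empty
    show ?case by (auto simp: homogeneous_def)
  next
    case (insert x F)
    then show ?case by (metis homogeneous_mult insertCI prod.insert)
  qed
  show ?thesis unfolding vander_def using X by (intro prod) auto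
qed

lemma vander_nonzero: "vander M \<noteq> 0"
proof -
  have "X i - X j \<noteq> 0" if "i < j" for i j
  proof
    assume "X i - X j = 0"
    then have "lookp (X i) (exp1 i) = lookp (X j) (exp1 i)" by simp
    then show False using that single_inj[of i 0 j] by (simp add: lookup_single when_def split: if_splits)
  qed
  then show ?thesis by (auto simp: vander_def)
qed

text \<open>The Vandermonde product is homogeneous of some degree \<open>c\<close>, so the component
  of degree \<open>n + c\<close> of the series product is a product of two polynomials, where
  cancellation is available.\<close>

lemma miwa_cancel_vandermonde:
  assumes "ms_mult (miwa M Z) (vandermonde M) = (\<lambda>\<beta>. 0)"
  shows "miwa_part M d Z = 0"
proof (cases "d < 0")
  case False
  then obtain n where d: "d = int n" by (metis nonneg_int_cases not_less)
  obtain c where c: "homogeneous c (vander M)" using homogeneous_vander by blast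
  have hom: "homogeneous n (miwa_part M d Z)"
    by (auto simp: homogeneous_def in_keys_iff lookup_miwa_part d split: if_splits)
  have "miwa_part M d Z * vander M = 0"
  proof (rule poly_mapping_eqI)
    fix \<beta>
    show "lookp (miwa_part M d Z * vander M) \<beta> = lookp 0 \<beta>"
    proof (cases "tot_deg \<beta> = n + c")
      case True
      have "lookp (miwa_part M d Z * vander M) \<beta> = ms_mult (miwa M Z) (lookp (vander M)) \<beta>"
        unfolding lookup_mult_ms_mult ms_mult_def
      proof (rule sum.cong[OF refl])
        fix p assume p: "p \<in> {p. fst p + snd p = \<beta>}"
        show "lookp (miwa_part M d Z) (fst p) * lookp (vander M) (snd p) = miwa M Z (fst p) * lookp (vander M) (snd p)"
        proof (cases "lookp (vander M) (snd p) = 0")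
          case False
          then have "tot_deg (snd p) = c" using c by (simp add: homogeneous_def in_keys_iff)
          then have "tot_deg (fst p) = n" using p True tot_deg_add[of "fst p" "snd p"] by simp
          then show ?thesis by (simp add: lookup_miwa_part d)
        qed simp
      qed
      then show ?thesis by (simp add: lookup_vander assms)
    next
      case False
      then show ?thesis using homogeneous_mult[OF hom c] by (auto simp: homogeneous_def in_keys_iff)
    qed
  qed
  then show ?thesis using vander_nonzero by simp
qed (simp add: miwa_part_neg)

text \<open>One spare variable \<open>x_M\<close> serves as a probe: differentiating in it gives
  \<open>\<Sum>l x_M^{2l} q_l = 0\<close>. The \<open>q_l\<close> themselves depend on
  \<open>x_M\<close>, so powers cannot be compared directly; but once all \<open>q_l\<close> with
  \<open>l < k\<close> vanish, the coefficient of \<open>x_M^{2k}\<close> is \<open>q_k\<close> at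
  \<open>x_M = 0\<close>, the image in \<open>M\<close> variables.\<close>

lemma miwa_part_dT_eq_0:
  assumes "\<And>M d. M \<ge> 1 \<Longrightarrow> miwa_part M d Z = 0" "M \<ge> 1"
  shows "miwa_part M d (dT k Z) = 0"
  using assms(2)
proof (induction k arbitrary: M d rule: less_induct)
  case (less k)
  define K where "K = nat d + 2 * k + 2"
  \<comment> \<open>The degree \<open>d + 2k + 1\<close> is chosen so that \<open>q k\<close> has
    degree \<open>d\<close>.\<close>
  define q where "q l = miwa_part (Suc M) (d + 2 * int k + 1 - 2 * int l - 1) (dT l Z)" for l
  have K: "d + 2 * int k + 1 \<le> 2 * int K" "k < K" by (auto simp: K_def)
  have qk: "q k = miwa_part (Suc M) d (dT k Z)" by (simp add: q_def)
  have low: "q l = 0" if "l < k" for l unfolding q_def by (rule less(1)[OF that]) simp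
  have "lookp (q k) \<gamma> = 0" if \<gamma>: "lookp \<gamma> M = 0" for \<gamma>
  proof -
    let ?\<beta> = "Poly_Mapping.single M (2*k) + \<gamma>"
    have "(\<Sum>l<K. X M ^ (2*l) * q l) = dX M (miwa_part (Suc M) (d + 2 * int k + 1) Z)"
      by (simp only: dX_miwa_part[OF lessI K(1)] q_def)
    also have "\<dots> = 0" by (simp add: assms(1))
    finally have zero: "(\<Sum>l<K. X M ^ (2*l) * q l) = 0" .
    have "0 = lookp (\<Sum>l<K. X M ^ (2*l) * q l) ?\<beta>" unfolding zero by simp
    also have "\<dots> = (\<Sum>l<K. lookp (X M ^ (2*l) * q l) ?\<beta>)" by (rule lookup_sum)
    also have "\<dots> = (\<Sum>l<K. if l = k then lookp (q k) \<gamma> else 0)"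
    proof (rule sum.cong[OF refl])
      fix l
      consider "l < k" | "l = k" | "k < l" by linarith
      then show "lookp (X M ^ (2*l) * q l) ?\<beta> = (if l = k then lookp (q k) \<gamma> else 0)"
      proof cases
        case 2
        then show ?thesis unfolding X_power by (simp add: lookup_single_mult)
      next
        case 3
        have "?\<beta> \<noteq> Poly_Mapping.single M (2*l) + \<delta>" for \<delta>
        proof
          assume "?\<beta> = Poly_Mapping.single M (2*l) + \<delta>"
          then have "lookp ?\<beta> M = lookp (Poly_Mapping.single M (2*l) + \<delta>) M" by simp
          then show False using 3 \<gamma> by (simp add: lookup_add)
        qed
        then show ?thesis unfolding X_power using 3 by (simp add: lookup_single_mult_eq_0)
      qed (simp add: low)
    qed
    finally show ?thesis using K(2) by simp
  qed
  then have "kill M (q k) = 0" by (intro poly_mapping_eqI) (simp add: lookup_kill)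
  then show ?case by (simp add: qk kill_miwa_part_Suc)
qed

lemma miwa_injective:
  assumes "\<And>M d. M \<ge> 1 \<Longrightarrow> miwa_part M d Z = 0"
  shows "Z \<alpha> = 0"
  using assms
proof (induction "odd_weight \<alpha>" arbitrary: \<alpha> Z rule: less_induct)
  case less
  show ?case
  proof (cases "\<alpha> = 0")
    case True
    have "Cst (Z 0) = 0" using less(2)[of 1 0] by (simp add: miwa_part_0)
    then show ?thesis using True by (metis lookup_single_eq lookup_zero)
  next
    case False
    then obtain k where "k \<in> Poly_Mapping.keys \<alpha>" by fastforce
    then obtain \<beta> where \<beta>: "\<alpha> = \<beta> + exp1 k" "odd_weight \<alpha> = odd_weight \<beta> + 2*k+1"
      using exp1_decompose by blast
    have "dT k Z \<beta> = 0"
      by (rule less(1)) (use \<beta>(2) miwa_part_dT_eq_0[OF less(2)] in auto)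
    moreover have "of_nat (lookp \<beta> k + 1) \<noteq> (0::complex)" by (metis Suc_eq_plus1 of_nat_neq_0)
    ultimately show ?thesis by (simp add: dT_eq \<beta>(1) del: of_nat_add of_nat_Suc)
  qed
qed

lemma BGW_tau_unique:
  assumes "is_BGW_tau N hbar \<tau>" "is_BGW_tau N hbar \<tau>'"
  shows "\<tau> = \<tau>'"
proof
  fix \<alpha>
  let ?E = "\<lambda>\<alpha>. \<tau> \<alpha> - \<tau>' \<alpha>"
  have "miwa_part M d ?E = 0" if "M \<ge> 1" for M d
  proof (rule miwa_cancel_vandermonde)
    have "miwa M ?E \<beta> = miwa M \<tau> \<beta> - miwa M \<tau>' \<beta>" for \<beta>
      by (simp add: miwa_def left_diff_distrib sum_subtractf)
    moreover have "ms_mult (miwa M \<tau>) (vandermonde M) = ms_mult (miwa M \<tau>') (vandermonde M)"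
      using assms that by (simp add: is_BGW_tau_def)
    ultimately show "ms_mult (miwa M ?E) (vandermonde M) = (\<lambda>\<beta>. 0)"
      by (simp add: ms_mult_def fun_eq_iff left_diff_distrib sum_subtractf)
  qed
  then have "?E \<alpha> = 0" by (rule miwa_injective)
  then show "\<tau> \<alpha> = \<tau>' \<alpha>" by simp
qed

theorem mainTheorem3:
  fixes N hbar :: complex
  assumes "hbar \<noteq> 0"
  shows "(\<exists>\<tau>. is_BGW_tau N hbar \<tau>)
       \<and> (\<forall>\<tau>. is_BGW_tau N hbar \<tau> \<longrightarrow>
             \<tau> 0 = 1 \<and> (\<forall>Z. is_BGW_solution N hbar Z \<longleftrightarrow> (\<exists>c. Z = (\<lambda>\<alpha>. c * \<tau> \<alpha>))))
       \<and> (\<exists>!Z. is_BGW_solution N hbar Z \<and> Z 0 = 1)"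
proof -
  let ?T = "BGW_series N hbar"
  have sol: "is_BGW_solution N hbar ?T" and T0: "?T 0 = 1"
    by (rule BGW_series_solution, rule BGW_series_zero)
  have tau: "is_BGW_tau N hbar ?T" by (rule BGW_solution_imp_tau[OF sol T0])
  have span: "is_BGW_solution N hbar Z \<longleftrightarrow> (\<exists>c. Z = (\<lambda>\<alpha>. c * ?T \<alpha>))" for Z
  proof
    assume "is_BGW_solution N hbar Z"
    then have "Z = (\<lambda>\<alpha>. Z 0 * ?T \<alpha>)"
      by (rule BGW_solution_unique[OF _ BGW_solution_scale[OF sol]]) (simp add: T0)
    then show "\<exists>c. Z = (\<lambda>\<alpha>. c * ?T \<alpha>)" by blast
  qed (auto intro: BGW_solution_scale[OF sol])
  have "\<tau> = ?T" if "is_BGW_tau N hbar \<tau>" for \<tau>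
    by (rule BGW_tau_unique[OF that tau])
  moreover have "\<exists>!Z. is_BGW_solution N hbar Z \<and> Z 0 = 1"
    using sol T0 BGW_solution_unique by metis
  ultimately show ?thesis using tau span T0 by blast
qed

end
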